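(* Let $1\le k\le n$ and let $\lambda=(\lambda_1,\dots,\lambda_k)$ be a partition with at most $k$ parts (padded with zeros). Then $$B^{(n)}_k\,S_\lambda[X^{tq}]=\det\Big(S_{\lambda_r-r+c+1}[X^{tq}]-t^{k-c}\,S_{\lambda_r-r+c+1}[X^{tq}+X^t]\Big)_{r,c=1}^{k}.$$
   Context: Plethystic notation: for a rational function $E$ in $x_1,\dots,x_n,q,t$, $p_i[E]$ replaces each of $x_1,\dots,x_n,q,t$ by its $i$-th power; $f[E]$ for a symmetric function $f$ is defined via power sums. $S_j$ is the complete homogeneous symmetric function ($S_j=0$ for $j<0$), $S_\lambda[E]=\det(S_{\lambda_r-r+c}[E])_{r,c=1}^k$. $X=x_1+\cdots+x_n$, $X^{tq}=X(t-1)/(q-1)$, $X^t=X(t-1)$. For alphabets $A,B$, $R(A,B)=\prod_{a\in A,b\in B}(a-b)$. For a set $I$ of indices, $X_I=\sum_{i\in I}x_i$, $X_I^c=\sum_{i\in\{1,\dots,n\}\setminus I}x_i$, $x^I=\prod_{i\in I}x_i$. $\Theta_l$ replaces $x_l$ by $qx_l$. For $J\subseteq I$ and $l\ge0$, the Macdonald operator in the variables $\{x_i:i\in I\}$ is $M^{(I)}_l=t^{\binom l2}\sum_{J\subseteq I,|J|=l}\prod_{i\in J,j\in I\setminus J}(tx_i-x_j)\prod_{j\in J}\Theta_j$ ($M_0^{(I)}=\mathrm{id}$). The creation operator on symmetric functions of $x_1,\dots,x_n$ is $$B^{(n)}_k=\sum_{I\subseteq\{1,\dots,n\},|I|=k}\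 \sum_{l=0}^k(-t)^l\,x^I\,\frac{R(X_I,X_I^c/t)}{R(X_I,X_I^c)}\,M^{(I)}_l .$$
   Formalization: In the Macdonald operator the coefficient is taken as the product of the fractions (t x_i - x_j)/(x_i - x_j), not of t x_i - x_j alone; without the denominators the identity fails already for n = k = 2, lambda = (0,0). *)

theory Defs
  imports
    "HOL-Library.Poly_Mapping"
    "HOL-Library.Multiset"
    "HOL-Computational_Algebra.Fraction_Field"
    "Jordan_Normal_Form.Determinant"
begin

section \<open>The field of rational functions in \<open>x\<^sub>1, x\<^sub>2, \<dots>, q, t\<close>\<close>

datatype indet = IndQ | IndT | IndX nat

text \<open>Only present because the library needs an order on the indeterminates in order to
  show that polynomials over an integral domain form an integral domain.\<close>

instantiation indet :: linorder
begin

fun indet_code :: "indet \<Rightarrow> nat" where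
  "indet_code IndQ = 0"
| "indet_code IndT = 1"
| "indet_code (IndX i) = i + 2"

definition less_eq_indet :: "indet \<Rightarrow> indet \<Rightarrow> bool" where
  "less_eq_indet u v \<longleftrightarrow> indet_code u \<le> indet_code v"

definition less_indet :: "indet \<Rightarrow> indet \<Rightarrow> bool" where
  "less_indet u v \<longleftrightarrow> indet_code u < indet_code v"

instance
proof
  fix u v :: indet
  show "u = v" if "u \<le> v" "v \<le> u"
    using that unfolding less_eq_indet_def by (cases u; cases v) auto
qed (auto simp: less_eq_indet_def less_indet_def)

end

text \<open>Polynomials with rational coefficients: an element maps a monomial (given by its
  exponents) to its coefficient.\<close>

type_synonym 'v rpoly = "('v \<Rightarrow>\<^sub>0 nat) \<Rightarrow>\<^sub>0 rat"

type_synonym ratfun = "indet rpoly fract"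

instance fract :: ("{idom, ring_char_0}") field_char_0
proof
  show "inj (of_nat :: nat \<Rightarrow> 'a fract)"
  proof (rule injI)
    fix m n :: nat
    assume "(of_nat m :: 'a fract) = of_nat n"
    thus "m = n"
      by (simp add: of_nat_fract eq_fract)
  qed
qed

definition ind :: "indet \<Rightarrow> ratfun" where
  "ind v = Fract (Poly_Mapping.single (Poly_Mapping.single v 1) 1) 1"

abbreviation qvar :: ratfun where "qvar \<equiv> ind IndQ"
abbreviation tvar :: ratfun where "tvar \<equiv> ind IndT"
abbreviation xvar :: "nat \<Rightarrow> ratfun" where "xvar i \<equiv> ind (IndX i)"

definition eval_mono :: "('v \<Rightarrow> 'b :: comm_semiring_1) \<Rightarrow> ('v \<Rightarrow>\<^sub>0 nat) \<Rightarrow> 'b" where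
  "eval_mono \<sigma> m = (\<Prod>v\<in>Poly_Mapping.keys m. \<sigma> v ^ Poly_Mapping.lookup m v)"

definition eval_rpoly :: "('v \<Rightarrow> 'b :: field_char_0) \<Rightarrow> 'v rpoly \<Rightarrow> 'b" where
  "eval_rpoly \<sigma> p =
     (\<Sum>m\<in>Poly_Mapping.keys p. of_rat (Poly_Mapping.lookup p m) * eval_mono \<sigma> m)"

text \<open>Substitution of \<open>\<sigma> v\<close> for each indeterminate \<open>v\<close> in a rational function. The value does
  not depend on the fraction chosen; it is meaningful whenever some representing fraction has a
  denominator that does not vanish under \<open>\<sigma>\<close>, which is always so for the two kinds of
  substitutions used below (see \<open>subst_adams\<close> and \<open>subst_shift\<close>).\<close>

definition subst :: "(indet \<Rightarrow> ratfun) \<Rightarrow> ratfun \<Rightarrow> ratfun" where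
  "subst \<sigma> f = (THE g. \<exists>a b. b \<noteq> 0 \<and> f = Fract a b \<and> eval_rpoly \<sigma> b \<noteq> 0 \<and>
                   g = eval_rpoly \<sigma> a / eval_rpoly \<sigma> b)"

section \<open>Plethysm\<close>

definition plet_p :: "nat \<Rightarrow> ratfun \<Rightarrow> ratfun" where
  "plet_p i E = subst (\<lambda>v. ind v ^ i) E"

text \<open>A symmetric function is represented by its expression as a polynomial in the power
  sums \<open>p\<^sub>1, p\<^sub>2, \<dots>\<close>; the indeterminate with index \<open>i \<ge> 1\<close> stands for \<open>p\<^sub>i\<close>.\<close>

type_synonym symfun = "nat rpoly"

definition power_sum :: "nat \<Rightarrow> symfun" where
  "power_sum i = Poly_Mapping.single (Poly_Mapping.single i 1) 1"

definition plethysm :: "symfun \<Rightarrow> ratfun \<Rightarrow> ratfun" where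
  "plethysm f E = eval_rpoly (\<lambda>i. plet_p i E) f"

text \<open>The complete homogeneous symmetric functions in terms of power sums, by Newton's
  identity \<open>j h\<^sub>j = p\<^sub>1 h\<^bsub>j-1\<^esub> + \<dots> + p\<^sub>j h\<^sub>0\<close>. The lemma \<open>complete_alphabet\<close> below
  shows that this is the sum of all monomials of degree \<open>j\<close>.\<close>

fun complete_sym :: "nat \<Rightarrow> symfun" where
  "complete_sym 0 = 1"
| "complete_sym (Suc j) = Poly_Mapping.single 0 (1 / of_nat (Suc j)) *
     (\<Sum>i\<le>j. power_sum (Suc i) * complete_sym (j - i))"

definition S_pleth :: "int \<Rightarrow> ratfun \<Rightarrow> ratfun" where
  "S_pleth j E = (if j < 0 then 0 else plethysm (complete_sym (nat j)) E)"

text \<open>The determinant of \<open>(a\<^sub>r\<^sub>c)\<close> with \<open>r, c\<close> running over \<open>1, \<dots>, k\<close>; library matrices are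
  indexed from \<open>0\<close>.\<close>

definition det1 :: "nat \<Rightarrow> (nat \<Rightarrow> nat \<Rightarrow> 'a :: comm_ring_1) \<Rightarrow> 'a" where
  "det1 k a = det (mat k k (\<lambda>(i, j). a (Suc i) (Suc j)))"

definition schur :: "nat \<Rightarrow> (nat \<Rightarrow> nat) \<Rightarrow> ratfun \<Rightarrow> ratfun" where
  "schur k lam E = det1 k (\<lambda>r c. S_pleth (int (lam r) - int r + int c) E)"

definition X_alph :: "nat \<Rightarrow> ratfun" where
  "X_alph n = (\<Sum>i = 1..n. xvar i)"

definition X_tq :: "nat \<Rightarrow> ratfun" where
  "X_tq n = X_alph n * (tvar - 1) / (qvar - 1)"

definition X_t :: "nat \<Rightarrow> ratfun" where
  "X_t n = X_alph n * (tvar - 1)"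

section \<open>Macdonald operators and creation operators\<close>

text \<open>All alphabets to which \<open>resultant_R\<close> is applied are sets of distinct letters.\<close>

definition resultant_R :: "ratfun set \<Rightarrow> ratfun set \<Rightarrow> ratfun" where
  "resultant_R A B = (\<Prod>a\<in>A. \<Prod>b\<in>B. a - b)"

definition Theta :: "nat \<Rightarrow> ratfun \<Rightarrow> ratfun" where
  "Theta l = subst (\<lambda>v. if v = IndX l then qvar * ind v else ind v)"

text \<open>The composition of the \<open>\<Theta>\<^sub>j\<close> with \<open>j \<in> J\<close>; these operators commute
  (see \<open>Theta_commute\<close> and \<open>Theta_set_insert\<close>).\<close>

definition Theta_set :: "nat set \<Rightarrow> ratfun \<Rightarrow> ratfun" where
  "Theta_set J f = Finite_Set.fold Theta f J"

text \<open>The coefficient is the usual one of Macdonald's operators, a product of the fractions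
  \<open>(t x\<^sub>i - x\<^sub>j) / (x\<^sub>i - x\<^sub>j)\<close>.\<close>

definition macdonald_op :: "nat set \<Rightarrow> nat \<Rightarrow> ratfun \<Rightarrow> ratfun" where
  "macdonald_op I l f = tvar ^ (l choose 2) *
     (\<Sum>J | J \<subseteq> I \<and> card J = l.
        (\<Prod>i\<in>J. \<Prod>j\<in>I - J. (tvar * xvar i - xvar j) / (xvar i - xvar j)) * Theta_set J f)"

definition creation_op :: "nat \<Rightarrow> nat \<Rightarrow> ratfun \<Rightarrow> ratfun" where
  "creation_op n k f =
     (\<Sum>I | I \<subseteq> {1..n} \<and> card I = k. \<Sum>l\<le>k.
        (- tvar) ^ l * (\<Prod>i\<in>I. xvar i) *
        (resultant_R (xvar ` I) ((\<lambda>j. xvar j / tvar) ` ({1..n} - I)) /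
         resultant_R (xvar ` I) (xvar ` ({1..n} - I))) *
        macdonald_op I l f)"

section \<open>Well-definedness of the substitutions\<close>

lemma eval_mono_superset:
  assumes "finite V" "Poly_Mapping.keys m \<subseteq> V"
  shows "eval_mono \<sigma> m = (\<Prod>v\<in>V. \<sigma> v ^ Poly_Mapping.lookup m v)"
  unfolding eval_mono_def using assms
  by (intro prod.mono_neutral_left) (auto simp: in_keys_iff)

lemma eval_mono_0 [simp]: "eval_mono \<sigma> 0 = 1"
  by (simp add: eval_mono_def)

lemma eval_mono_add: "eval_mono \<sigma> (m + m') = eval_mono \<sigma> m * eval_mono \<sigma> m'"
proof -
  let ?V = "Poly_Mapping.keys m \<union> Poly_Mapping.keys m'"
  have "Poly_Mapping.keys (m + m') \<subseteq> ?V" by (rule Poly_Mapping.keys_add)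
  thus ?thesis
    by (simp add: eval_mono_superset[of ?V] lookup_add power_add prod.distrib)
qed

lemma eval_mono_single [simp]: "eval_mono \<sigma> (Poly_Mapping.single v e) = \<sigma> v ^ e"
  by (simp add: eval_mono_def)

lemma eval_rpoly_superset:
  assumes "finite K" "Poly_Mapping.keys p \<subseteq> K"
  shows "eval_rpoly \<sigma> p = (\<Sum>m\<in>K. of_rat (Poly_Mapping.lookup p m) * eval_mono \<sigma> m)"
  unfolding eval_rpoly_def using assms
  by (intro sum.mono_neutral_left) (auto simp: in_keys_iff)

lemma eval_rpoly_0 [simp]: "eval_rpoly \<sigma> 0 = 0"
  by (simp add: eval_rpoly_def)

lemma eval_rpoly_single:
  "eval_rpoly \<sigma> (Poly_Mapping.single m c) = of_rat c * eval_mono \<sigma> m"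
  by (simp add: eval_rpoly_def)

lemma eval_rpoly_1 [simp]: "eval_rpoly \<sigma> 1 = 1"
  using eval_rpoly_single[of \<sigma> 0 1] by simp

lemma eval_rpoly_add: "eval_rpoly \<sigma> (p + p') = eval_rpoly \<sigma> p + eval_rpoly \<sigma> p'"
proof -
  let ?V = "Poly_Mapping.keys p \<union> Poly_Mapping.keys p'"
  have "Poly_Mapping.keys (p + p') \<subseteq> ?V" by (rule Poly_Mapping.keys_add)
  thus ?thesis
    by (simp add: eval_rpoly_superset[of ?V] lookup_add of_rat_add sum.distrib distrib_right)
qed

lemma eval_rpoly_sum: "eval_rpoly \<sigma> (sum f A) = (\<Sum>a\<in>A. eval_rpoly \<sigma> (f a))"
  by (induction A rule: infinite_finite_induct) (auto simp: eval_rpoly_add)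

lemma rpoly_sum_monomials:
  "(\<Sum>m\<in>Poly_Mapping.keys p. Poly_Mapping.single m (Poly_Mapping.lookup p m)) = p"
proof (rule poly_mapping_eqI)
  fix m
  show "Poly_Mapping.lookup (\<Sum>m\<in>Poly_Mapping.keys p.
          Poly_Mapping.single m (Poly_Mapping.lookup p m)) m = Poly_Mapping.lookup p m"
    by (simp add: lookup_sum lookup_single when_def in_keys_iff)
qed

lemma eval_rpoly_mult: "eval_rpoly \<sigma> (p * p') = eval_rpoly \<sigma> p * eval_rpoly \<sigma> p'"
proof -
  have "p * p' = (\<Sum>m\<in>Poly_Mapping.keys p. \<Sum>m'\<in>Poly_Mapping.keys p'.
      Poly_Mapping.single (m + m') (Poly_Mapping.lookup p m * Poly_Mapping.lookup p' m'))"
    using arg_cong2[OF rpoly_sum_monomials[of p] rpoly_sum_monomials[of p'], of "(*)"]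
    by (simp add: sum_product mult_single)
  hence "eval_rpoly \<sigma> (p * p') = (\<Sum>m\<in>Poly_Mapping.keys p. \<Sum>m'\<in>Poly_Mapping.keys p'.
      of_rat (Poly_Mapping.lookup p m * Poly_Mapping.lookup p' m') * eval_mono \<sigma> (m + m'))"
    by (simp add: eval_rpoly_sum eval_rpoly_single)
  also have "\<dots> = eval_rpoly \<sigma> p * eval_rpoly \<sigma> p'"
    unfolding eval_rpoly_def sum_product
    by (intro sum.cong refl) (simp add: eval_mono_add of_rat_mult mult_ac)
  finally show ?thesis .
qed

lemma subst_Fract:
  assumes "b \<noteq> 0" "eval_rpoly \<sigma> b \<noteq> 0"
  shows "subst \<sigma> (Fract a b) = eval_rpoly \<sigma> a / eval_rpoly \<sigma> b"
  unfolding subst_def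
proof (rule the_equality)
  fix g
  assume "\<exists>c d. d \<noteq> 0 \<and> Fract a b = Fract c d \<and> eval_rpoly \<sigma> d \<noteq> 0 \<and>
            g = eval_rpoly \<sigma> c / eval_rpoly \<sigma> d"
  then obtain c d where cd: "d \<noteq> 0" "Fract a b = Fract c d" "eval_rpoly \<sigma> d \<noteq> 0"
    "g = eval_rpoly \<sigma> c / eval_rpoly \<sigma> d" by blast
  from cd assms have "a * d = c * b" by (simp add: eq_fract)
  hence "eval_rpoly \<sigma> a * eval_rpoly \<sigma> d = eval_rpoly \<sigma> c * eval_rpoly \<sigma> b"
    by (metis eval_rpoly_mult)
  thus "g = eval_rpoly \<sigma> a / eval_rpoly \<sigma> b"
    using cd assms by (simp add: frac_eq_eq)
qed (use assms in blast)

text \<open>A substitution of monomials for the indeterminates: \<open>v\<close> is replaced by the monomial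
  \<open>\<phi> v\<close>.\<close>

definition mono_ind :: "(indet \<Rightarrow>\<^sub>0 nat) \<Rightarrow> ratfun" where
  "mono_ind m = Fract (Poly_Mapping.single m 1) 1"

definition mono_map :: "(indet \<Rightarrow> (indet \<Rightarrow>\<^sub>0 nat)) \<Rightarrow> (indet \<Rightarrow>\<^sub>0 nat) \<Rightarrow> (indet \<Rightarrow>\<^sub>0 nat)" where
  "mono_map \<phi> m = (\<Sum>v\<in>Poly_Mapping.keys m. \<Sum>_<Poly_Mapping.lookup m v. \<phi> v)"

lemma mono_ind_0 [simp]: "mono_ind 0 = 1"
  by (simp add: mono_ind_def One_fract_def)

lemma mono_ind_add: "mono_ind (m + m') = mono_ind m * mono_ind m'"
  by (simp add: mono_ind_def mult_single)

lemma mono_ind_sum: "mono_ind (sum f A) = (\<Prod>a\<in>A. mono_ind (f a))"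
  by (induction A rule: infinite_finite_induct) (auto simp: mono_ind_add)

lemma ind_eq_mono_ind: "ind v = mono_ind (Poly_Mapping.single v 1)"
  by (simp add: ind_def mono_ind_def)

lemma mono_ind_power: "mono_ind (Poly_Mapping.single v i) = ind v ^ i"
proof (induction i)
  case (Suc i)
  have "Poly_Mapping.single v (Suc i) = Poly_Mapping.single v 1 + Poly_Mapping.single v i"
    by (simp add: Poly_Mapping.single_add[symmetric])
  thus ?case by (simp add: mono_ind_add ind_eq_mono_ind Suc)
qed simp

lemma eval_mono_mono_ind:
  "eval_mono (\<lambda>v. mono_ind (\<phi> v)) m = mono_ind (mono_map \<phi> m)"
  by (simp add: eval_mono_def mono_map_def mono_ind_sum)

lemma of_int_fract: "of_int k = Fract (of_int k) (1 :: 'a :: idom)"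
  by (cases k rule: int_cases2) (simp_all add: of_nat_fract)

lemma of_rat_ratfun: "(of_rat c :: ratfun) = Fract (Poly_Mapping.single 0 c) 1"
proof (cases c)
  case (Fract a b)
  have "(of_rat c :: ratfun) = of_int a / of_int b"
    using Fract by (simp add: of_rat_rat)
  also have "\<dots> = Fract (of_int a) (of_int b)"
    by (simp add: of_int_fract)
  also have "\<dots> = Fract (Poly_Mapping.single 0 c) 1"
  proof -
    have 1: "(of_int z :: indet rpoly) = Poly_Mapping.single 0 (of_int z)" for z
      by simp
    have "(of_int b :: indet rpoly) \<noteq> 0" using Fract by simp
    moreover have "(of_int a :: indet rpoly) = Poly_Mapping.single 0 c * of_int b"
      unfolding 1 mult_single using Fract by (simp add: Fract_of_int_quotient)
    ultimately show ?thesis by (simp add: eq_fract)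
  qed
  finally show ?thesis .
qed

lemma Fract_sum_1: "(\<Sum>a\<in>A. Fract (f a) 1) = Fract (sum f A) (1 :: 'a :: idom)"
  by (induction A rule: infinite_finite_induct) (auto simp: Zero_fract_def)

lemma eval_rpoly_mono_ind:
  "eval_rpoly (\<lambda>v. mono_ind (\<phi> v)) p =
     Fract (\<Sum>m\<in>Poly_Mapping.keys p. Poly_Mapping.single (mono_map \<phi> m) (Poly_Mapping.lookup p m)) 1"
  unfolding eval_rpoly_def eval_mono_mono_ind
  by (simp add: of_rat_ratfun mono_ind_def mult_single Fract_sum_1[symmetric])

lemma eval_rpoly_mono_ind_nonzero:
  assumes "inj (mono_map \<phi>)" "p \<noteq> 0"
  shows "eval_rpoly (\<lambda>v. mono_ind (\<phi> v)) p \<noteq> 0"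
proof
  assume "eval_rpoly (\<lambda>v. mono_ind (\<phi> v)) p = 0"
  hence 0: "(\<Sum>m\<in>Poly_Mapping.keys p.
      Poly_Mapping.single (mono_map \<phi> m) (Poly_Mapping.lookup p m)) = 0"
    by (simp add: eval_rpoly_mono_ind Zero_fract_def eq_fract)
  from assms obtain m0 where m0: "m0 \<in> Poly_Mapping.keys p"
    by (metis equals0I keys_eq_empty)
  have "0 = Poly_Mapping.lookup (\<Sum>m\<in>Poly_Mapping.keys p.
      Poly_Mapping.single (mono_map \<phi> m) (Poly_Mapping.lookup p m)) (mono_map \<phi> m0)"
    by (simp add: 0)
  also have "\<dots> = (\<Sum>m\<in>Poly_Mapping.keys p. if m = m0 then Poly_Mapping.lookup p m else 0)"
    unfolding lookup_sum
    by (intro sum.cong refl) (use assms(1) in \<open>auto simp: lookup_single when_def dest: injD\<close>)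
  also have "\<dots> = Poly_Mapping.lookup p m0" using m0 by simp
  finally show False using m0 by (simp add: in_keys_iff)
qed

lemma lookup_mono_map:
  "Poly_Mapping.lookup (mono_map \<phi> m) w =
     (\<Sum>v\<in>Poly_Mapping.keys m. Poly_Mapping.lookup m v * Poly_Mapping.lookup (\<phi> v) w)"
  by (simp add: mono_map_def lookup_sum)

definition adams_exp :: "nat \<Rightarrow> indet \<Rightarrow> (indet \<Rightarrow>\<^sub>0 nat)" where
  "adams_exp i v = Poly_Mapping.single v i"

definition shift_exp :: "nat set \<Rightarrow> indet \<Rightarrow> (indet \<Rightarrow>\<^sub>0 nat)" where
  "shift_exp J v = (if v \<in> IndX ` J then Poly_Mapping.single IndQ 1 else 0) + Poly_Mapping.single v 1"

lemma inj_adams_exp: "i > 0 \<Longrightarrow> inj (mono_map (adams_exp i))"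
proof (rule injI)
  fix m m' :: "indet \<Rightarrow>\<^sub>0 nat"
  assume i: "i > 0" and eq: "mono_map (adams_exp i) m = mono_map (adams_exp i) m'"
  have *: "Poly_Mapping.lookup (mono_map (adams_exp i) m) w = i * Poly_Mapping.lookup m w" for m w
  proof -
    have "Poly_Mapping.lookup (mono_map (adams_exp i) m) w =
        (\<Sum>v\<in>Poly_Mapping.keys m. if v = w then i * Poly_Mapping.lookup m v else 0)"
      unfolding lookup_mono_map adams_exp_def
      by (intro sum.cong refl) (auto simp: lookup_single when_def)
    also have "\<dots> = i * Poly_Mapping.lookup m w" by (simp add: in_keys_iff)
    finally show ?thesis .
  qed
  show "m = m'"
    by (rule poly_mapping_eqI) (use i *[of m] *[of m'] eq in \<open>auto\<close>)
qed

lemma inj_shift_exp: "inj (mono_map (shift_exp J))"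
proof (rule injI)
  fix m m' :: "indet \<Rightarrow>\<^sub>0 nat"
  assume eq: "mono_map (shift_exp J) m = mono_map (shift_exp J) m'"
  define d where "d m = (\<Sum>v\<in>Poly_Mapping.keys m. if v \<in> IndX ` J then Poly_Mapping.lookup m v else 0)"
    for m :: "indet \<Rightarrow>\<^sub>0 nat"
  have *: "Poly_Mapping.lookup (mono_map (shift_exp J) m) w =
      (if w = IndQ then d m else 0) + Poly_Mapping.lookup m w" for m w
  proof -
    have "Poly_Mapping.lookup (mono_map (shift_exp J) m) w =
        (\<Sum>v\<in>Poly_Mapping.keys m.
           (if w = IndQ then if v \<in> IndX ` J then Poly_Mapping.lookup m v else 0 else 0) +
           (if v = w then Poly_Mapping.lookup m v else 0))"
      unfolding lookup_mono_map shift_exp_def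
      by (intro sum.cong refl) (auto simp: lookup_single lookup_add when_def)
    also have "\<dots> = (if w = IndQ then d m else 0) + Poly_Mapping.lookup m w"
      by (simp add: sum.distrib d_def in_keys_iff)
    finally show ?thesis .
  qed
  have ne: "Poly_Mapping.lookup m w = Poly_Mapping.lookup m' w" if "w \<noteq> IndQ" for w
    using *[of m w] *[of m' w] eq that by simp
  have d: "d m = d m'"
  proof -
    let ?K = "Poly_Mapping.keys m \<union> Poly_Mapping.keys m'"
    have "d m = (\<Sum>v\<in>?K. if v \<in> IndX ` J then Poly_Mapping.lookup m v else 0)"
      unfolding d_def by (intro sum.mono_neutral_left) (auto simp: in_keys_iff)
    also have "\<dots> = (\<Sum>v\<in>?K. if v \<in> IndX ` J then Poly_Mapping.lookup m' v else 0)"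
      by (intro sum.cong refl) (auto simp: ne)
    also have "\<dots> = d m'"
      unfolding d_def by (intro sum.mono_neutral_right) (auto simp: in_keys_iff)
    finally show ?thesis .
  qed
  show "m = m'"
  proof (rule poly_mapping_eqI)
    fix w show "Poly_Mapping.lookup m w = Poly_Mapping.lookup m' w"
      using ne[of w] *[of m w] *[of m' w] eq d by (cases "w = IndQ") auto
  qed
qed

lemma adams_nonzero:
  "i > 0 \<Longrightarrow> p \<noteq> 0 \<Longrightarrow> eval_rpoly (\<lambda>v. ind v ^ i) p \<noteq> 0"
  using eval_rpoly_mono_ind_nonzero[OF inj_adams_exp, of i p]
  by (simp add: adams_exp_def mono_ind_power)

lemma mono_ind_shift_exp:
  "mono_ind (shift_exp J v) = (if v \<in> IndX ` J then qvar * ind v else ind v)"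
  by (simp add: shift_exp_def mono_ind_add ind_eq_mono_ind)

lemma shift_nonzero:
  "p \<noteq> 0 \<Longrightarrow> eval_rpoly (\<lambda>v. if v \<in> IndX ` J then qvar * ind v else ind v) p \<noteq> 0"
  using eval_rpoly_mono_ind_nonzero[OF inj_shift_exp, of p J]
  by (simp add: mono_ind_shift_exp)

lemma subst_adams:
  "i > 0 \<Longrightarrow> b \<noteq> 0 \<Longrightarrow> plet_p i (Fract a b) =
     eval_rpoly (\<lambda>v. ind v ^ i) a / eval_rpoly (\<lambda>v. ind v ^ i) b"
  unfolding plet_p_def by (intro subst_Fract adams_nonzero)

lemma subst_shift:
  fixes J defines "\<sigma> \<equiv> (\<lambda>v. if v \<in> IndX ` J then qvar * ind v else ind v)"
  assumes "b \<noteq> 0"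
  shows "subst \<sigma> (Fract a b) = eval_rpoly \<sigma> a / eval_rpoly \<sigma> b"
  unfolding \<sigma>_def by (intro subst_Fract shift_nonzero assms)

text \<open>Substitutions that never annihilate a denominator are field endomorphisms over the
  rationals.\<close>

locale good_subst =
  fixes \<sigma> :: "indet \<Rightarrow> ratfun"
  assumes nonzero: "p \<noteq> 0 \<Longrightarrow> eval_rpoly \<sigma> p \<noteq> 0"
begin

lemma Fract': "b \<noteq> 0 \<Longrightarrow> subst \<sigma> (Fract a b) = eval_rpoly \<sigma> a / eval_rpoly \<sigma> b"
  by (intro subst_Fract nonzero)

lemma add: "subst \<sigma> (f + g) = subst \<sigma> f + subst \<sigma> g"
  by (cases f; cases g) (simp add: Fract' eval_rpoly_add eval_rpoly_mult nonzero field_simps)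

lemma mult: "subst \<sigma> (f * g) = subst \<sigma> f * subst \<sigma> g"
  by (cases f; cases g) (simp add: Fract' eval_rpoly_mult)

lemma of_rat [simp]: "subst \<sigma> (of_rat c) = of_rat c"
  by (simp add: of_rat_ratfun[of c] Fract' eval_rpoly_single)

lemma zero [simp]: "subst \<sigma> 0 = 0"
  using of_rat[of 0] by simp

lemma one [simp]: "subst \<sigma> 1 = 1"
  using of_rat[of 1] by simp

lemma ind [simp]: "subst \<sigma> (ind v) = \<sigma> v"
  by (simp add: ind_def Fract' eval_rpoly_single)

lemma uminus: "subst \<sigma> (- f) = - subst \<sigma> f"
  using add[of f "-f"] by (simp add: eq_neg_iff_add_eq_0 add.commute)

lemma diff: "subst \<sigma> (f - g) = subst \<sigma> f - subst \<sigma> g"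
  using add[of f "-g"] by (simp add: uminus)

lemma inverse: "subst \<sigma> (inverse f) = inverse (subst \<sigma> f)"
proof (cases "f = 0")
  case False
  hence "subst \<sigma> f * subst \<sigma> (inverse f) = 1" by (simp flip: mult)
  thus ?thesis by (rule inverse_unique[symmetric])
qed simp

lemma divide: "subst \<sigma> (f / g) = subst \<sigma> f / subst \<sigma> g"
  by (simp add: divide_inverse mult inverse)

lemma power: "subst \<sigma> (f ^ n) = subst \<sigma> f ^ n"
  by (induction n) (simp_all add: mult)

lemma sum: "subst \<sigma> (sum h A) = (\<Sum>a\<in>A. subst \<sigma> (h a))"
  by (induction A rule: infinite_finite_induct) (simp_all add: add)

lemma prod: "subst \<sigma> (prod h A) = (\<Prod>a\<in>A. subst \<sigma> (h a))"
  by (induction A rule: infinite_finite_induct) (simp_all add: mult)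

end

lemma good_subst_adams: "i > 0 \<Longrightarrow> good_subst (\<lambda>v. ind v ^ i)"
  by standard (rule adams_nonzero)

lemma good_subst_shift: "good_subst (\<lambda>v. if v \<in> IndX ` J then qvar * ind v else ind v)"
  by standard (rule shift_nonzero)

lemma plet_p_X_alph: "i > 0 \<Longrightarrow> plet_p i (X_alph n) = (\<Sum>j = 1..n. xvar j ^ i)"
  unfolding plet_p_def X_alph_def
  by (simp add: good_subst.sum[OF good_subst_adams] good_subst.ind[OF good_subst_adams])

lemma subst_eval_rpoly:
  assumes "good_subst \<tau>"
  shows "subst \<tau> (eval_rpoly \<sigma> p) = eval_rpoly (\<lambda>v. subst \<tau> (\<sigma> v)) p"
proof -
  interpret good_subst \<tau> by fact
  show ?thesis by (simp add: eval_rpoly_def eval_mono_def sum mult prod power)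
qed

abbreviation shift_set :: "nat set \<Rightarrow> ratfun \<Rightarrow> ratfun" where
  "shift_set J \<equiv> subst (\<lambda>v. if v \<in> IndX ` J then qvar * ind v else ind v)"

lemma Theta_eq_shift_set: "Theta l = shift_set {l}"
  by (simp add: Theta_def)

lemma Theta_shift_set:
  assumes "l \<notin> J"
  shows "Theta l (shift_set J f) = shift_set (insert l J) f"
proof (cases f)
  case (Fract a b)
  let ?\<sigma> = "\<lambda>J v. if v \<in> IndX ` J then qvar * ind v else ind v"
  interpret l: good_subst "?\<sigma> {l}" by (rule good_subst_shift)
  have eq: "(\<lambda>v. subst (?\<sigma> {l}) (?\<sigma> J v)) = ?\<sigma> (insert l J)"
    using assms l.ind l.mult by (auto simp: fun_eq_iff)
  have "Theta l (shift_set J f) = shift_set {l} (eval_rpoly (?\<sigma> J) a / eval_rpoly (?\<sigma> J) b)"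
    unfolding Theta_eq_shift_set Fract(1) by (subst subst_shift[OF Fract(2)]) (rule refl)
  also have "\<dots> = eval_rpoly (?\<sigma> (insert l J)) a / eval_rpoly (?\<sigma> (insert l J)) b"
    unfolding l.divide subst_eval_rpoly[OF good_subst_shift] eq by (rule refl)
  also have "\<dots> = shift_set (insert l J) f"
    unfolding Fract(1) by (rule subst_shift[OF Fract(2), symmetric])
  finally show ?thesis .
qed

lemma Theta_commute: "Theta l \<circ> Theta m = Theta m \<circ> Theta l"
proof (cases "l = m")
  case False
  have *: "Theta i (Theta j f) = shift_set {i, j} f" if "i \<noteq> j" for i j f
    using that Theta_shift_set[of i "{j}" f] by (simp only: Theta_eq_shift_set[of j]) simp
  show ?thesis
    using False by (simp add: fun_eq_iff * insert_commute)
qed simp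

lemma Theta_set_empty [simp]: "Theta_set {} f = f"
  by (simp add: Theta_set_def)

lemma Theta_set_insert:
  assumes "finite J" "l \<notin> J"
  shows "Theta_set (insert l J) f = Theta l (Theta_set J f)"
proof -
  interpret comp_fun_commute Theta
    by standard (rule Theta_commute)
  show ?thesis using assms by (simp add: Theta_set_def)
qed

section \<open>Complete symmetric functions are sums of monomials\<close>

definition h_sum :: "'i set \<Rightarrow> ('i \<Rightarrow> 'b :: field_char_0) \<Rightarrow> nat \<Rightarrow> 'b" where
  "h_sum A x j = (\<Sum>M | set_mset M \<subseteq> A \<and> size M = j. \<Prod>i\<in>#M. x i)"

lemma finite_multisets_of_size:
  assumes "finite A"
  shows "finite {M. set_mset M \<subseteq> A \<and> size M = j}"
proof (rule finite_subset)
  show "{M. set_mset M \<subseteq> A \<and> size M = j} \<subseteq> mset ` {xs. set xs \<subseteq> A \<and> length xs = j}"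
  proof
    fix M assume M: "M \<in> {M. set_mset M \<subseteq> A \<and> size M = j}"
    obtain xs where "M = mset xs" using ex_mset by metis
    with M show "M \<in> mset ` {xs. set xs \<subseteq> A \<and> length xs = j}" by auto
  qed
  show "finite (mset ` {xs. set xs \<subseteq> A \<and> length xs = j})"
    using assms by (intro finite_imageI finite_lists_length_eq)
qed

lemma h_sum_newton:
  assumes "finite A"
  shows "of_nat j * h_sum A x j = (\<Sum>i=1..j. (\<Sum>a\<in>A. x a ^ i) * h_sum A x (j - i))"
proof -
  define Ms where "Ms j = {M. set_mset M \<subseteq> A \<and> size M = j}" for j
  define w where "w M = (\<Prod>i\<in>#M. x i)" for M
  have fin: "finite (Ms j)" for j
    unfolding Ms_def using assms by (rule finite_multisets_of_size)
  have one: "(\<Sum>i=1..j. x a ^ i * h_sum A x (j - i)) = (\<Sum>M\<in>Ms j. of_nat (count M a) * w M)"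
    if a: "a \<in> A" for a
  proof -
    have "(\<Sum>i=1..j. x a ^ i * h_sum A x (j - i)) =
        (\<Sum>i=1..j. \<Sum>M\<in>Ms (j - i). w (replicate_mset i a + M))"
      by (simp add: h_sum_def sum_distrib_left Ms_def w_def)
    also have "\<dots> = (\<Sum>i=1..j. \<Sum>M\<in>{M\<in>Ms j. i \<le> count M a}. w M)"
    proof (rule sum.cong[OF refl])
      fix i assume i: "i \<in> {1..j}"
      show "(\<Sum>M\<in>Ms (j - i). w (replicate_mset i a + M)) = (\<Sum>M\<in>{M\<in>Ms j. i \<le> count M a}. w M)"
      proof (rule sum.reindex_bij_witness[of _ "\<lambda>M. M - replicate_mset i a" "\<lambda>M. replicate_mset i a + M"])
        fix M assume "M \<in> {M\<in>Ms j. i \<le> count M a}"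
        hence M: "replicate_mset i a \<subseteq># M" "M \<in> Ms j"
          by (auto simp: count_le_replicate_mset_subset_eq)
        show "replicate_mset i a + (M - replicate_mset i a) = M"
          using M by simp
        show "M - replicate_mset i a \<in> Ms (j - i)"
          using M by (auto simp: Ms_def size_Diff_submset dest: in_diffD)
      qed (use a i in \<open>auto simp: Ms_def split: if_splits\<close>)
    qed
    also have "\<dots> = (\<Sum>i=1..j. \<Sum>M\<in>Ms j. if i \<le> count M a then w M else 0)"
      using fin by (simp add: sum.inter_filter)
    also have "\<dots> = (\<Sum>M\<in>Ms j. \<Sum>i=1..j. if i \<le> count M a then w M else 0)"
      by (rule sum.swap)
    also have "\<dots> = (\<Sum>M\<in>Ms j. of_nat (count M a) * w M)"
    proof (rule sum.cong[OF refl])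
      fix M assume "M \<in> Ms j"
      hence le: "count M a \<le> j"
        using count_le_size[of M a] by (simp add: Ms_def)
      have "(\<Sum>i=1..j. if i \<le> count M a then w M else 0) = (\<Sum>i\<in>{i\<in>{1..j}. i \<le> count M a}. w M)"
        by (rule sum.inter_filter[symmetric]) simp
      also have "{i\<in>{1..j}. i \<le> count M a} = {1..count M a}"
        using le by auto
      finally show "(\<Sum>i=1..j. if i \<le> count M a then w M else 0) = of_nat (count M a) * w M"
        by simp
    qed
    finally show ?thesis .
  qed
  have "(\<Sum>i=1..j. (\<Sum>a\<in>A. x a ^ i) * h_sum A x (j - i)) =
      (\<Sum>a\<in>A. \<Sum>i=1..j. x a ^ i * h_sum A x (j - i))"
    by (simp add: sum_distrib_right sum.swap[of _ A])
  also have "\<dots> = (\<Sum>a\<in>A. \<Sum>M\<in>Ms j. of_nat (count M a) * w M)"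
    by (intro sum.cong refl one)
  also have "\<dots> = (\<Sum>M\<in>Ms j. of_nat (\<Sum>a\<in>A. count M a) * w M)"
    by (subst sum.swap) (simp add: sum_distrib_right)
  also have "\<dots> = (\<Sum>M\<in>Ms j. of_nat j * w M)"
  proof (rule sum.cong[OF refl])
    fix M assume "M \<in> Ms j"
    hence "set_mset M \<subseteq> A" "size M = j" by (auto simp: Ms_def)
    hence "(\<Sum>a\<in>A. count M a) = j"
      using assms by (simp add: size_multiset_overloaded_eq)
        (metis (mono_tags, lifting) count_eq_zero_iff DiffD2 sum.mono_neutral_right)
    thus "of_nat (\<Sum>a\<in>A. count M a) * w M = of_nat j * w M" by simp
  qed
  also have "\<dots> = of_nat j * h_sum A x j"
    by (simp add: h_sum_def sum_distrib_left Ms_def w_def)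
  finally show ?thesis ..
qed

lemma plethysm_power_sum [simp]: "plethysm (power_sum i) E = plet_p i E"
  by (simp add: plethysm_def power_sum_def eval_rpoly_single)

lemma plethysm_complete_0 [simp]: "plethysm (complete_sym 0) E = 1"
  by (simp add: plethysm_def)

lemma plethysm_complete_Suc:
  "of_nat (Suc j) * plethysm (complete_sym (Suc j)) E =
     (\<Sum>i\<le>j. plet_p (Suc i) E * plethysm (complete_sym (j - i)) E)"
proof -
  have "plethysm (complete_sym (Suc j)) E = of_rat (1 / of_nat (Suc j)) *
      (\<Sum>i\<le>j. plet_p (Suc i) E * plethysm (complete_sym (j - i)) E)"
    by (simp add: plethysm_def eval_rpoly_mult eval_rpoly_sum eval_rpoly_single power_sum_def)
  thus ?thesis
    by (simp add: of_rat_divide del: of_nat_Suc complete_sym.simps)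
qed

lemma complete_alphabet:
  "S_pleth (int j) (X_alph n) = (\<Sum>M | set_mset M \<subseteq> {1..n} \<and> size M = j. \<Prod>i\<in>#M. xvar i)"
proof -
  have "plethysm (complete_sym j) (X_alph n) = h_sum {1..n} xvar j"
  proof (induction j rule: less_induct)
    case (less j)
    show ?case
    proof (cases j)
      case 0
      have "{M. set_mset M \<subseteq> {1..n} \<and> size M = 0} = {{#}}" by auto
      thus ?thesis using 0 by (simp add: h_sum_def del: complete_sym.simps)
    next
      case (Suc k)
      have "of_nat j * plethysm (complete_sym j) (X_alph n) =
          (\<Sum>i\<le>k. plet_p (Suc i) (X_alph n) * plethysm (complete_sym (k - i)) (X_alph n))"
        unfolding Suc by (rule plethysm_complete_Suc)
      also have "\<dots> = (\<Sum>i\<le>k. (\<Sum>a = 1..n. xvar a ^ Suc i) * h_sum {1..n} xvar (k - i))"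
        by (intro sum.cong refl arg_cong2[of _ _ _ _ "(*)"] plet_p_X_alph less) (auto simp: Suc)
      also have "\<dots> = (\<Sum>i=1..j. (\<Sum>a = 1..n. xvar a ^ i) * h_sum {1..n} xvar (j - i))"
        unfolding Suc
        by (rule sum.reindex_bij_witness[of _ "\<lambda>i. i - 1" Suc]) auto
      also have "\<dots> = of_nat j * h_sum {1..n} xvar j"
        by (rule h_sum_newton[symmetric]) simp
      finally show ?thesis using Suc by (simp del: of_nat_Suc complete_sym.simps)
    qed
  qed
  thus ?thesis by (simp add: S_pleth_def h_sum_def)
qed

end

theory Submission
  imports Defs "HOL-Computational_Algebra.Formal_Power_Series"
begin

text \<open>Let \<open>G(z) = \<Sum>\<^sub>j S\<^sub>j[X\<^sup>t\<^sup>q] z\<^sup>j\<close>. The shift of the variables in \<open>J\<close> multiplies \<open>G\<close> by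
  \<open>\<Prod>\<^bsub>j\<in>J\<^esub> (1 - x\<^sub>j z) / (1 - t x\<^sub>j z)\<close>, and \<open>X\<^sup>t\<^sup>q + X\<^sup>t\<close> is the shift of all variables. Row \<open>r\<close> of
  every determinant is a coefficient of such a series, so both sides are obtained by applying
  one linear functional per row, in the variable \<open>w\<^sub>r = 1/z\<^sub>r\<close>, to the two sides of an identity of
  rational functions in \<open>w\<^sub>1, \<dots>, w\<^sub>k\<close>. Since evaluations at generic points span these functionals,
  it suffices to prove that identity. After clearing denominators both sides are polynomials in \<open>w\<^sub>1\<close>
  of degree less than \<open>n + k\<close>, and they agree at the \<open>n + k\<close> points \<open>t x\<^sub>a\<close> (where the identity
  reduces to the one for \<open>k - 1\<close> without \<open>x\<^sub>a\<close>), \<open>w\<^sub>2, \<dots>, w\<^sub>k\<close> (equal rows) and \<open>0\<close> (where both sides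
  vanish).\<close>

section \<open>Determinants and Vandermonde ratios\<close>

lemma det_mat_leibniz:
  "det (mat k k (\<lambda>(r, c). f r c)) =
     (\<Sum>p | p permutes {0..<k}. signof p * (\<Prod>i<k. f i (p i)))"
proof -
  have "det (mat k k (\<lambda>(r, c). f r c)) =
      (\<Sum>p | p permutes {0..<k}. signof p * (\<Prod>i = 0..<k. mat k k (\<lambda>(r, c). f r c) $$ (i, p i)))"
    by (rule det_def') simp
  also have "\<dots> = (\<Sum>p | p permutes {0..<k}. signof p * (\<Prod>i<k. f i (p i)))"
  proof (intro sum.cong refl arg_cong2[of _ _ _ _ "(*)"])
    fix p assume "p \<in> {p. p permutes {0..<k}}"
    hence "p i < k" if "i < k" for i
      using that permutes_in_image[of p "{0..<k}" i] by simp
    thus "(\<Prod>i = 0..<k. mat k k (\<lambda>(r, c). f r c) $$ (i, p i)) = (\<Prod>i<k. f i (p i))"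
      by (intro prod.cong) auto
  qed
  finally show ?thesis .
qed

lemma det_mat_cong:
  assumes "\<And>r c. r < k \<Longrightarrow> c < k \<Longrightarrow> f r c = g r c"
  shows "det (mat k k (\<lambda>(r, c). f r c)) = det (mat k k (\<lambda>(r, c). g r c))"
  by (intro arg_cong[of _ _ det] eq_matI) (use assms in auto)

lemma det_scale_rows:
  "det (mat k k (\<lambda>(r, c). a r * f r c)) = (\<Prod>r<k. a r) * det (mat k k (\<lambda>(r, c). f r c))"
  unfolding det_mat_leibniz by (simp add: prod.distrib sum_distrib_left mult_ac)

lemma det_add_rows_subsets:
  "det (mat k k (\<lambda>(r, c). a r c + b r c)) =
     (\<Sum>K\<in>Pow {..<k}. det (mat k k (\<lambda>(r, c). if r \<in> K then a r c else b r c)))"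
proof -
  have *: "(\<Prod>i<k. a i (p i) + b i (p i)) =
      (\<Sum>K\<in>Pow {..<k}. \<Prod>i<k. if i \<in> K then a i (p i) else b i (p i))" for p
  proof -
    have "(\<Prod>i\<in>K. a i (p i)) * (\<Prod>i\<in>{..<k} - K. b i (p i)) =
        (\<Prod>i<k. if i \<in> K then a i (p i) else b i (p i))" if "K \<in> Pow {..<k}" for K
      using that by (subst prod.If_cases) (auto simp: Int_absorb1 Int_absorb2 Diff_eq)
    thus ?thesis by (simp add: prod_add)
  qed
  show ?thesis
    unfolding det_mat_leibniz * sum_distrib_left by (rule sum.swap)
qed

text \<open>Subtracting \<open>y\<close> times the preceding column from every column but the first
  turns row 0 into \<open>(1, 0, ..., 0)\<close>. The unitriangular matrix \<open>U\<close> performs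
  all these column operations at once, and expansion along row 0 leaves the smaller
  determinant.\<close>

lemma det_geometric_row:
  fixes f :: "nat \<Rightarrow> nat \<Rightarrow> 'a :: idom"
  assumes row: "\<And>c. c \<le> k \<Longrightarrow> f 0 c = y ^ c"
  shows "det (mat (Suc k) (Suc k) (\<lambda>(r, c). f r c)) =
     det (mat k k (\<lambda>(r, c). f (Suc r) (Suc c) - y * f (Suc r) c))"
proof -
  let ?M = "mat (Suc k) (Suc k) (\<lambda>(r, c). f r c)"
  define U :: "'a mat" where
    "U = mat (Suc k) (Suc k) (\<lambda>(i, j). if i = j then 1 else if Suc i = j then - y else 0)"
  define M' where
    "M' = mat (Suc k) (Suc k) (\<lambda>(r, c). if c = 0 then f r 0 else f r c - y * f r (c - 1))"
  have U: "U \<in> carrier_mat (Suc k) (Suc k)" by (simp add: U_def)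
  have "det U = prod_list (diag_mat U)"
    by (rule det_upper_triangular[OF _ U]) (auto simp: U_def)
  also have "diag_mat U = replicate (Suc k) 1"
    by (rule nth_equalityI) (auto simp: diag_mat_def U_def simp del: upt_Suc replicate_Suc)
  finally have detU: "det U = 1" by simp
  have "?M * U = M'"
  proof (rule eq_matI)
    fix r c assume "r < dim_row M'" "c < dim_col M'"
    hence rc: "r < Suc k" "c < Suc k" by (auto simp: M'_def)
    have "(?M * U) $$ (r, c) =
        (\<Sum>i = 0..<Suc k. f r i * (if i = c then 1 else if Suc i = c then - y else 0))"
      using rc by (simp add: times_mat_def scalar_prod_def U_def)
    also have "\<dots> = (\<Sum>i = 0..<Suc k. (if i = c then f r i else 0) +
        (if Suc i = c then - y * f r (c - 1) else 0))"
      by (intro sum.cong) auto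
    also have "\<dots> = M' $$ (r, c)"
    proof (cases c)
      case (Suc d)
      thus ?thesis using rc by (simp add: sum.distrib M'_def del: sum.op_ivl_Suc)
    qed (use rc in \<open>simp add: sum.distrib M'_def del: sum.op_ivl_Suc\<close>)
    finally show "(?M * U) $$ (r, c) = M' $$ (r, c)" .
  qed (auto simp: M'_def U_def)
  hence "det M' = det ?M"
    using det_mult[of ?M "Suc k" U] U detU by simp
  moreover have "det M' = (\<Sum>j<Suc k. M' $$ (0, j) * cofactor M' 0 j)"
    by (rule laplace_expansion_row) (auto simp: M'_def)
  moreover have "\<dots> = (\<Sum>j<Suc k. if j = 0 then cofactor M' 0 0 else 0)"
  proof (intro sum.cong refl)
    fix j assume "j \<in> {..<Suc k}"
    thus "M' $$ (0, j) * cofactor M' 0 j = (if j = 0 then cofactor M' 0 0 else 0)"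
      by (cases j) (auto simp: M'_def row)
  qed
  moreover have "mat_delete M' 0 0 = mat k k (\<lambda>(r, c). f (Suc r) (Suc c) - y * f (Suc r) c)"
    by (rule eq_matI) (auto simp: mat_delete_def M'_def)
  ultimately show ?thesis by (simp add: cofactor_def)
qed

lemma det_vandermonde:
  fixes y :: "nat \<Rightarrow> 'a :: idom"
  shows "det (mat k k (\<lambda>(r, c). y r ^ c)) = (\<Prod>j<k. \<Prod>i<j. y j - y i)"
proof (induction k arbitrary: y)
  case (Suc k)
  have "det (mat (Suc k) (Suc k) (\<lambda>(r, c). y r ^ c)) =
      det (mat k k (\<lambda>(r, c). (y (Suc r) - y 0) * y (Suc r) ^ c))"
    by (subst det_geometric_row[where y = "y 0"]) (auto simp: algebra_simps intro!: det_mat_cong)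
  also have "\<dots> = (\<Prod>r<k. y (Suc r) - y 0) * (\<Prod>j<k. \<Prod>i<j. y (Suc j) - y (Suc i))"
    by (simp add: det_scale_rows Suc)
  finally show ?case
    by (simp add: prod.lessThan_Suc_shift prod.distrib del: prod.lessThan_Suc)
qed simp

text \<open>The coefficient of the shift by \<open>J\<close> in the Macdonald operator on the
  variables in \<open>I\<close>, with its power of \<open>t\<close> included.\<close>

definition crossing_weight :: "'a :: field \<Rightarrow> ('i \<Rightarrow> 'a) \<Rightarrow> 'i set \<Rightarrow> 'i set \<Rightarrow> 'a" where
  "crossing_weight t x I J =
     t ^ (card J choose 2) * (\<Prod>i\<in>J. \<Prod>j\<in>I - J. (t * x i - x j) / (x i - x j))"

text \<open>In the ratio of the two Vandermonde products a pair inside \<open>K\<close> contributes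
  \<open>t\<close>, a pair outside \<open>K\<close> contributes 1, and a mixed pair contributes one
  of the fractions in \<open>crossing_weight\<close>. The induction adds the last point, so only the
  pairs containing it are new.\<close>

lemma vandermonde_dilate:
  fixes x :: "nat \<Rightarrow> 'a :: field"
  assumes "inj_on x {..<k}" "K \<subseteq> {..<k}"
  shows "(\<Prod>j<k. \<Prod>i<j. (if j \<in> K then t * x j else x j) - (if i \<in> K then t * x i else x i)) =
    crossing_weight t x {..<k} K * (\<Prod>j<k. \<Prod>i<j. x j - x i)"
  using assms
proof (induction k arbitrary: K)
  case 0
  thus ?case by (simp add: crossing_weight_def numeral_2_eq_2)
next
  case (Suc k)
  define y where "y K j = (if j \<in> K then t * x j else x j)" for K j
  define L where "L = K - {k}"
  have L: "L \<subseteq> {..<k}" using Suc.prems(2) by (auto simp: L_def less_Suc_eq)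
  have fin: "finite L" using L finite_subset by auto
  have ne: "x k - x i \<noteq> 0" "x i - x k \<noteq> 0" if "i < k" for i
    using that inj_onD[OF Suc.prems(1), of k i] by auto
  have IH: "(\<Prod>j<k. \<Prod>i<j. y L j - y L i) = crossing_weight t x {..<k} L * (\<Prod>j<k. \<Prod>i<j. x j - x i)"
    unfolding y_def by (rule Suc.IH[OF _ L]) (use Suc.prems(1) in \<open>auto simp: inj_on_def\<close>)
  have yK: "y K j = y L j" if "j < k" for j
    using that by (auto simp: y_def L_def)
  have split: "(\<Prod>i<k. f i) = (\<Prod>i\<in>L. f i) * (\<Prod>i\<in>{..<k} - L. f i)" for f :: "nat \<Rightarrow> 'a"
    using prod.subset_diff[OF L, of f] by (simp add: mult.commute)
  have last: "(\<Prod>i<k. y K k - y K i) * crossing_weight t x {..<k} L =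
      crossing_weight t x {..<Suc k} K * (\<Prod>i<k. x k - x i)"
  proof (cases "k \<in> K")
    case True
    hence K: "K = insert k L" by (auto simp: L_def)
    have kL: "k \<notin> L" by (simp add: L_def)
    have D: "{..<Suc k} - K = {..<k} - L" using K by auto
    have cardK: "card K = Suc (card L)" using fin kL by (simp add: K)
    have "(\<Prod>i<k. y K k - y K i) = (\<Prod>i\<in>L. y K k - y K i) * (\<Prod>i\<in>{..<k} - L. y K k - y K i)"
      by (rule split)
    also have "(\<Prod>i\<in>L. y K k - y K i) = (\<Prod>i\<in>L. t * (x k - x i))"
      using True by (intro prod.cong) (auto simp: y_def K algebra_simps)
    also have "(\<Prod>i\<in>{..<k} - L. y K k - y K i) =
        (\<Prod>i\<in>{..<k} - L. (t * x k - x i) / (x k - x i) * (x k - x i))"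
      using True ne by (intro prod.cong) (auto simp: y_def K)
    finally have "(\<Prod>i<k. y K k - y K i) = t ^ card L *
        (\<Prod>i\<in>{..<k} - L. (t * x k - x i) / (x k - x i)) *
        ((\<Prod>i\<in>L. x k - x i) * (\<Prod>i\<in>{..<k} - L. x k - x i))"
      by (simp only: prod.distrib prod_constant mult_ac)
    also have "(\<Prod>i\<in>L. x k - x i) * (\<Prod>i\<in>{..<k} - L. x k - x i) = (\<Prod>i<k. x k - x i)"
      by (rule split[symmetric])
    finally show ?thesis
      unfolding crossing_weight_def D cardK
      by (simp add: K fin kL power_add numeral_2_eq_2)
  next
    case False
    hence K: "K = L" by (auto simp: L_def)
    have kL: "k \<notin> L" by (simp add: L_def)
    have D: "{..<Suc k} - L = insert k ({..<k} - L)" using kL by auto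
    have "(\<Prod>i<k. y K k - y K i) = (\<Prod>i\<in>L. y K k - y K i) * (\<Prod>i\<in>{..<k} - L. y K k - y K i)"
      by (rule split)
    also have "(\<Prod>i\<in>L. y K k - y K i) = (\<Prod>i\<in>L. (t * x i - x k) / (x i - x k) * (x k - x i))"
    proof (intro prod.cong refl)
      fix i assume "i \<in> L"
      hence "i < k" using L by auto
      thus "y K k - y K i = (t * x i - x k) / (x i - x k) * (x k - x i)"
        using False ne[of i] \<open>i \<in> L\<close> by (simp add: y_def K field_simps)
    qed
    also have "(\<Prod>i\<in>{..<k} - L. y K k - y K i) = (\<Prod>i\<in>{..<k} - L. x k - x i)"
      using False by (intro prod.cong) (auto simp: y_def K)
    finally have "(\<Prod>i<k. y K k - y K i) = (\<Prod>i\<in>L. (t * x i - x k) / (x i - x k)) *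
        ((\<Prod>i\<in>L. x k - x i) * (\<Prod>i\<in>{..<k} - L. x k - x i))"
      by (simp only: prod.distrib mult.assoc)
    also have "(\<Prod>i\<in>L. x k - x i) * (\<Prod>i\<in>{..<k} - L. x k - x i) = (\<Prod>i<k. x k - x i)"
      by (rule split[symmetric])
    finally have last: "(\<Prod>i<k. y K k - y K i) =
        (\<Prod>i\<in>L. (t * x i - x k) / (x i - x k)) * (\<Prod>i<k. x k - x i)" .
    have insert: "(\<Prod>j\<in>insert k ({..<k} - L). f j) = f k * (\<Prod>j\<in>{..<k} - L. f j)"
      for f :: "nat \<Rightarrow> 'a"
      by simp
    show ?thesis
      unfolding last unfolding crossing_weight_def K D
      by (simp only: insert prod.distrib mult_ac)
  qed
  have "(\<Prod>j<Suc k. \<Prod>i<j. y K j - y K i) = (\<Prod>j<k. \<Prod>i<j. y L j - y L i) * (\<Prod>i<k. y K k - y K i)"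
    by (simp add: yK)
  also have "\<dots> = (\<Prod>i<k. y K k - y K i) * crossing_weight t x {..<k} L * (\<Prod>j<k. \<Prod>i<j. x j - x i)"
    unfolding IH by (simp add: mult_ac)
  also have "\<dots> = crossing_weight t x {..<Suc k} K * (\<Prod>j<Suc k. \<Prod>i<j. x j - x i)"
    unfolding last by (simp add: mult_ac)
  finally show ?case by (simp only: y_def)
qed

text \<open>By \<open>vandermonde_dilate\<close>, each term times the Vandermonde product of the
  points is a determinant. Together these determinants are the row expansion of a single one: row
  \<open>r\<close> is the sum of the powers of \<open>t * x r\<close> with factor
  \<open>- poly P (x r)\<close> and the powers of \<open>x r\<close> with factor
  \<open>poly P (t * x r)\<close>. That matrix is singular, and the Vandermonde product cancels
  because the points are distinct.\<close>

lemma crossing_sum_zero_lessThan: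
  fixes x :: "nat \<Rightarrow> 'a :: field"
  assumes inj: "inj_on x {..<k}" and deg: "degree P < k" and P: "P \<noteq> 0"
  shows "(\<Sum>K\<in>Pow {..<k}. (-1) ^ card K * crossing_weight t x {..<k} K *
           (\<Prod>i\<in>K. poly P (x i)) * (\<Prod>i\<in>{..<k} - K. poly P (t * x i))) = 0"
    (is "?S = 0")
proof -
  define V where "V = (\<Prod>j<k. \<Prod>i<j. x j - x i)"
  have "x j - x i \<noteq> 0" if "j < k" "i < j" for i j
    using inj_onD[OF inj, of j i] that by auto
  hence V: "V \<noteq> 0"
    unfolding V_def by simp
  let ?a = "\<lambda>r c. - poly P (x r) * (t * x r) ^ c"
  let ?b = "\<lambda>r c. poly P (t * x r) * x r ^ c"
  let ?M = "mat k k (\<lambda>(r, c). ?a r c + ?b r c)"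
  \<comment> \<open>The coefficients of \<open>P\<close> form a kernel vector: row \<open>r\<close> applied to them gives
    \<open>P(t x\<^sub>r) P(x\<^sub>r) - P(x\<^sub>r) P(t x\<^sub>r)\<close>.\<close>
  have "det ?M = 0"
  proof -
    define v where "v = vec k (coeff P)"
    have sum: "(\<Sum>c<k. coeff P c * z ^ c) = poly P z" for z
    proof -
      have "poly P z = (\<Sum>c\<le>degree P. coeff P c * z ^ c)" by (rule poly_altdef)
      also have "\<dots> = (\<Sum>c<k. coeff P c * z ^ c)"
        using deg by (intro sum.mono_neutral_left) (auto simp: coeff_eq_0)
      finally show ?thesis ..
    qed
    have "v \<noteq> 0\<^sub>v k"
    proof
      assume "v = 0\<^sub>v k"
      hence "v $ degree P = 0" using deg by simp
      thus False using deg P by (simp add: v_def)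
    qed
    moreover have "?M *\<^sub>v v = 0\<^sub>v k"
    proof (rule eq_vecI)
      fix r assume r: "r < dim_vec (0\<^sub>v k :: 'a vec)"
      hence "(?M *\<^sub>v v) $ r = (\<Sum>c<k. (?a r c + ?b r c) * coeff P c)"
        by (simp add: scalar_prod_def v_def atLeast0LessThan)
      also have "\<dots> = poly P (t * x r) * (\<Sum>c<k. coeff P c * x r ^ c) -
          poly P (x r) * (\<Sum>c<k. coeff P c * (t * x r) ^ c)"
        by (simp add: sum_distrib_left algebra_simps flip: sum_subtractf)
      also have "\<dots> = 0" by (simp only: sum) simp
      finally show "(?M *\<^sub>v v) $ r = 0\<^sub>v k $ r" using r by simp
    qed simp
    moreover have "v \<in> carrier_vec k" by (simp add: v_def)
    ultimately show ?thesis
      using det_0_iff_vec_prod_zero_field[of ?M k] by auto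
  qed
  also have "det ?M = (\<Sum>K\<in>Pow {..<k}. det (mat k k (\<lambda>(r, c).
      (if r \<in> K then - poly P (x r) else poly P (t * x r)) * (if r \<in> K then t * x r else x r) ^ c)))"
    unfolding det_add_rows_subsets by (intro sum.cong refl det_mat_cong) auto
  also have "\<dots> = ?S * V"
    unfolding sum_distrib_right
  proof (intro sum.cong refl)
    fix K assume "K \<in> Pow {..<k}"
    hence K: "K \<subseteq> {..<k}" by simp
    hence fin: "finite K" using finite_subset by auto
    have "(\<Prod>r<k. if r \<in> K then - poly P (x r) else poly P (t * x r)) =
        (\<Prod>r\<in>K. - poly P (x r)) * (\<Prod>r\<in>{..<k} - K. poly P (t * x r))"
      using K by (subst prod.If_cases) (auto simp: Int_absorb1 Int_absorb2 Diff_eq)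
    also have "(\<Prod>r\<in>K. - poly P (x r)) = (-1) ^ card K * (\<Prod>r\<in>K. poly P (x r))"
      using fin by (simp add: prod_uminus)
    finally show "det (mat k k (\<lambda>(r, c).
        (if r \<in> K then - poly P (x r) else poly P (t * x r)) * (if r \<in> K then t * x r else x r) ^ c)) =
        (-1) ^ card K * crossing_weight t x {..<k} K *
          (\<Prod>i\<in>K. poly P (x i)) * (\<Prod>i\<in>{..<k} - K. poly P (t * x i)) * V"
      unfolding det_scale_rows det_vandermonde vandermonde_dilate[OF inj K] V_def
      by (simp add: mult_ac)
  qed
  finally show ?thesis using V by simp
qed

text \<open>Vandermonde products need an order of the points, whereas the sum does not; an
  enumeration of \<open>I\<close> carries the result over.\<close>

lemma crossing_sum_zero:
  fixes x :: "'i \<Rightarrow> 'a :: field"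
  assumes "finite I" and inj: "inj_on x I" and deg: "degree P < card I" and P: "P \<noteq> 0"
  shows "(\<Sum>J\<in>Pow I. (-1) ^ card J * crossing_weight t x I J *
           (\<Prod>i\<in>J. poly P (x i)) * (\<Prod>i\<in>I - J. poly P (t * x i))) = 0"
proof -
  obtain h where h: "bij_betw h {..<card I} I"
    using ex_bij_betw_nat_finite[OF assms(1)] by (auto simp: atLeast0LessThan)
  have injh: "inj_on h {..<card I}" and im: "h ` {..<card I} = I"
    using h by (auto simp: bij_betw_def)
  have "(\<Sum>J\<in>Pow I. (-1) ^ card J * crossing_weight t x I J *
           (\<Prod>i\<in>J. poly P (x i)) * (\<Prod>i\<in>I - J. poly P (t * x i))) =
     (\<Sum>K\<in>Pow {..<card I}. (-1) ^ card K * crossing_weight t (x \<circ> h) {..<card I} K *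
           (\<Prod>i\<in>K. poly P ((x \<circ> h) i)) * (\<Prod>i\<in>{..<card I} - K. poly P (t * (x \<circ> h) i)))"
  proof (rule sum.reindex_bij_betw[OF bij_betw_Pow[OF h], symmetric, THEN trans], intro sum.cong refl)
    fix K assume "K \<in> Pow {..<card I}"
    hence K: "K \<subseteq> {..<card I}" by simp
    have iK: "inj_on h K" "inj_on h ({..<card I} - K)"
      using injh K by (auto intro: inj_on_subset)
    have D: "I - h ` K = h ` ({..<card I} - K)"
      using inj_on_image_set_diff[OF injh, of "{..<card I}" K] K im by auto
    show "(-1) ^ card (h ` K) * crossing_weight t x I (h ` K) *
           (\<Prod>i\<in>h ` K. poly P (x i)) * (\<Prod>i\<in>I - h ` K. poly P (t * x i)) =
       (-1) ^ card K * crossing_weight t (x \<circ> h) {..<card I} K *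
           (\<Prod>i\<in>K. poly P ((x \<circ> h) i)) * (\<Prod>i\<in>{..<card I} - K. poly P (t * (x \<circ> h) i))"
      unfolding crossing_weight_def D
      by (simp add: prod.reindex iK card_image)
  qed
  also have "\<dots> = 0"
    by (rule crossing_sum_zero_lessThan) (use inj injh im deg P in \<open>auto intro: comp_inj_on\<close>)
  finally show ?thesis .
qed

section \<open>The identity as a multilinear form in the rows\<close>

text \<open>The numerator of \<open>\<Prod>\<^bsub>j\<in>J\<^esub> (w - x\<^sub>j) / (w - t x\<^sub>j)\<close> over the common denominator
  \<open>\<Prod>\<^bsub>j\<in>A\<^esub> (w - t x\<^sub>j)\<close>.\<close>

definition shift_poly :: "'a :: field \<Rightarrow> ('i \<Rightarrow> 'a) \<Rightarrow> 'i set \<Rightarrow> 'i set \<Rightarrow> 'a poly" where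
  "shift_poly t x A J = (\<Prod>j\<in>J. [:- x j, 1:]) * (\<Prod>j\<in>A - J. [:- (t * x j), 1:])"

text \<open>The linear functional with \<open>w^s\<close> sent to \<open>u s\<close>, on polynomials
  of degree below \<open>D\<close>. Powers of \<open>y\<close> as \<open>u\<close> give evaluation
  at \<open>y\<close>; coefficients of a power series as \<open>u\<close> give coefficient
  extraction.\<close>

definition row_val :: "nat \<Rightarrow> (nat \<Rightarrow> 'a) \<Rightarrow> 'a :: field poly \<Rightarrow> 'a" where
  "row_val D u N = (\<Sum>s<D. u s * coeff N s)"

text \<open>This is \<open>x^I R(X_I, X_I^c/t) / R(X_I, X_I^c)\<close> with \<open>A\<close> as the
  full index set, written over indices instead of sets of letters.\<close>

definition choice_weight :: "'a :: field \<Rightarrow> ('i \<Rightarrow> 'a) \<Rightarrow> 'i set \<Rightarrow> 'i set \<Rightarrow> 'a" where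
  "choice_weight t x A I =
     (\<Prod>i\<in>I. x i) * (\<Prod>i\<in>I. \<Prod>j\<in>A - I. (x i - x j / t) / (x i - x j))"

text \<open>The two sides of the theorem, where \<open>v r\<close> is the functional for row \<open>r\<close>, acting on
  polynomials of degree less than \<open>card A + k\<close>. All polynomials that occur satisfy this bound; for
  the last column of \<open>determinant_form\<close> this is due to a cancellation of leading terms.\<close>

definition creation_form where
  "creation_form t x A k v = (\<Sum>I | I \<subseteq> A \<and> card I = k. choice_weight t x A I *
     (\<Sum>J\<in>Pow I. (- t) ^ card J * crossing_weight t x I J *
       det (mat k k (\<lambda>(r, c). row_val (card A + k) (v r) (monom 1 c * shift_poly t x A J)))))"

definition determinant_form where
  "determinant_form t x A k v = det (mat k k (\<lambda>(r, c). row_val (card A + k) (v r)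
     (monom 1 (Suc c) * (shift_poly t x A {} - smult (t ^ (k - Suc c)) (shift_poly t x A A)))))"

text \<open>The form that arises when row \<open>r\<close> is evaluated at \<open>w r\<close>: the
  numerators factor out of the rows and leave a Vandermonde determinant.\<close>

definition creation_eval where
  "creation_eval t x A k w = (\<Sum>I | I \<subseteq> A \<and> card I = k. choice_weight t x A I *
     (\<Sum>J\<in>Pow I. (- t) ^ card J * crossing_weight t x I J *
       ((\<Prod>r<k. poly (shift_poly t x A J) (w r)) * det (mat k k (\<lambda>(r, c). w r ^ c)))))"

definition determinant_eval where
  "determinant_eval t x A k w = det (mat k k (\<lambda>(r, c). w r ^ Suc c *
     (poly (shift_poly t x A {}) (w r) - t ^ (k - Suc c) * poly (shift_poly t x A A) (w r))))"

section \<open>Degrees of the numerators, and both forms at evaluation functionals\<close>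

lemma poly_shift_poly:
  "poly (shift_poly t x A J) z = (\<Prod>j\<in>J. z - x j) * (\<Prod>j\<in>A - J. z - t * x j)"
  by (simp add: shift_poly_def poly_prod)

lemma degree_lead_coeff_shift_poly:
  assumes "finite A" "J \<subseteq> A"
  shows "degree (shift_poly t x A J) = card A" "coeff (shift_poly t x A J) (card A) = 1"
proof -
  have 1: "degree (\<Prod>j\<in>B. [:- y j, 1:]) = card B" "lead_coeff (\<Prod>j\<in>B. [:- y j, 1:]) = 1"
    for B :: "'a set" and y :: "'a \<Rightarrow> 'b"
    by (simp add: degree_prod_eq_sum_degree) (simp only: lead_coeff_prod, simp)
  have "(\<Prod>j\<in>B. [:- y j, 1:]) \<noteq> 0" for B :: "'a set" and y :: "'a \<Rightarrow> 'b"
    using 1(2)[of y B] by auto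
  hence "degree (shift_poly t x A J) = card J + card (A - J)"
    unfolding shift_poly_def by (subst degree_mult_eq) (simp_all add: 1)
  also have "\<dots> = card A"
    using assms by (simp add: card_Diff_subset finite_subset card_mono)
  finally show "degree (shift_poly t x A J) = card A" .
  moreover have "lead_coeff (shift_poly t x A J) = 1"
    by (simp only: shift_poly_def lead_coeff_mult 1(2) mult_1)
  ultimately show "coeff (shift_poly t x A J) (card A) = 1" by simp
qed

lemma row_val_powers:
  assumes "\<And>s. s \<ge> D \<Longrightarrow> coeff N s = 0"
  shows "row_val D (\<lambda>s. y ^ s) N = poly N y"
proof -
  have "poly N y = (\<Sum>s\<le>degree N. coeff N s * y ^ s)" by (rule poly_altdef)
  also have "\<dots> = (\<Sum>s<D. coeff N s * y ^ s)"
    using assms by (intro sum.mono_neutral_cong) (auto simp: coeff_eq_0 not_less)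
  finally show ?thesis by (simp add: row_val_def mult.commute)
qed

lemma creation_form_powers:
  assumes "finite A"
  shows "creation_form t x A k (\<lambda>r s. w r ^ s) = creation_eval t x A k w"
  unfolding creation_form_def creation_eval_def
proof (intro sum.cong refl arg_cong2[of _ _ _ _ "(*)"])
  fix I J assume IJ: "I \<in> {I. I \<subseteq> A \<and> card I = k}" "J \<in> Pow I"
  have coeff: "coeff (monom 1 c * shift_poly t x A J) s = 0" if "c < k" "s \<ge> card A + k" for c s
    using that IJ degree_lead_coeff_shift_poly[OF assms, of J t x]
    by (auto simp: coeff_monom_mult intro!: coeff_eq_0)
  have "det (mat k k (\<lambda>(r, c). row_val (card A + k) (\<lambda>s. w r ^ s) (monom 1 c * shift_poly t x A J))) =
      det (mat k k (\<lambda>(r, c). poly (shift_poly t x A J) (w r) * w r ^ c))"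
    by (intro det_mat_cong, subst row_val_powers) (auto simp: coeff poly_monom)
  thus "det (mat k k (\<lambda>(r, c). row_val (card A + k) (\<lambda>s. w r ^ s) (monom 1 c * shift_poly t x A J))) =
      (\<Prod>r<k. poly (shift_poly t x A J) (w r)) * det (mat k k (\<lambda>(r, c). w r ^ c))"
    by (simp add: det_scale_rows)
qed

text \<open>Degree \<open>card A + k\<close> can be reached only in the last column,
  \<open>Suc c = k\<close>. There the power of \<open>t\<close> is 1 and the two numerators, both
  monic of degree \<open>card A\<close>, lose their leading terms in the difference.\<close>

lemma coeff_shift_poly_diff_zero:
  assumes "finite A" "c < k" "s \<ge> card A + k"
  shows "coeff (monom 1 (Suc c) *
    (shift_poly t x A {} - smult (t ^ (k - Suc c)) (shift_poly t x A A))) s = 0"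
proof -
  define N where "N = shift_poly t x A {} - smult (t ^ (k - Suc c)) (shift_poly t x A A)"
  have top: "coeff N (card A) = 1 - t ^ (k - Suc c)"
    using degree_lead_coeff_shift_poly[OF assms(1), of _ t x] by (simp add: N_def)
  have above: "coeff N s = 0" if "s > card A" for s
    using that degree_lead_coeff_shift_poly[OF assms(1), of _ t x] by (simp add: N_def coeff_eq_0)
  have "coeff (monom 1 (Suc c) * N) s = 0"
  proof (cases "s - Suc c > card A")
    case True
    thus ?thesis using above by (simp add: coeff_monom_mult)
  next
    case False
    hence "Suc c = k" "s - Suc c = card A" using assms by auto
    thus ?thesis using top by (simp add: coeff_monom_mult)
  qed
  thus ?thesis by (simp only: N_def)
qed

lemma determinant_form_powers:
  assumes "finite A"
  shows "determinant_form t x A k (\<lambda>r s. w r ^ s) = determinant_eval t x A k w"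
  unfolding determinant_form_def determinant_eval_def
  by (intro det_mat_cong, subst row_val_powers)
     (simp_all add: coeff_shift_poly_diff_zero[OF assms] poly_monom)

section \<open>Functionals linear in each row, and their extension from generic points\<close>

definition row_linear :: "nat \<Rightarrow> nat \<Rightarrow> ((nat \<Rightarrow> nat \<Rightarrow> 'a :: field) \<Rightarrow> 'a) \<Rightarrow> bool" where
  "row_linear D k T \<longleftrightarrow> (\<forall>r<k. \<forall>v. \<exists>B. \<forall>u. T (v(r := u)) = (\<Sum>s<D. u s * B s))"

text \<open>Laplace expansion along row \<open>r0\<close>: the cofactors do not see that row, so
  they can be computed with its functional set to zero.\<close>

lemma row_linear_det:
  "row_linear D k (\<lambda>v. det (mat k k (\<lambda>(r, c). row_val D (v r) (p c))))"
  unfolding row_linear_def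
proof (intro allI impI)
  fix r0 v assume r0: "r0 < k"
  let ?M = "\<lambda>u. mat k k (\<lambda>(r, c). row_val D ((v(r0 := u)) r) (p c))"
  define C where "C c = cofactor (?M (\<lambda>_. 0)) r0 c" for c
  have C: "cofactor (?M u) r0 c = C c" if "c < k" for u c
    unfolding C_def cofactor_def mat_delete_def using that r0
    by (intro arg_cong2[of _ _ _ _ "(*)"] refl arg_cong[of _ _ det] eq_matI) auto
  have "det (?M u) = (\<Sum>s<D. u s * (\<Sum>c<k. coeff (p c) s * C c))" for u
  proof -
    have "det (?M u) = (\<Sum>c<k. ?M u $$ (r0, c) * cofactor (?M u) r0 c)"
      by (rule laplace_expansion_row) (use r0 in auto)
    also have "\<dots> = (\<Sum>c<k. row_val D u (p c) * C c)"
      by (intro sum.cong refl) (use r0 C in auto)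
    also have "\<dots> = (\<Sum>c<k. \<Sum>s<D. u s * (coeff (p c) s * C c))"
      by (simp add: row_val_def sum_distrib_right mult.assoc)
    also have "\<dots> = (\<Sum>s<D. u s * (\<Sum>c<k. coeff (p c) s * C c))"
      by (subst sum.swap) (simp add: sum_distrib_left)
    finally show ?thesis .
  qed
  thus "\<exists>B. \<forall>u. det (?M u) = (\<Sum>s<D. u s * B s)" by (intro exI allI)
qed

lemma row_linear_sum:
  assumes "\<And>i. i \<in> S \<Longrightarrow> row_linear D k (T i)"
  shows "row_linear D k (\<lambda>v. \<Sum>i\<in>S. T i v)"
  unfolding row_linear_def
proof (intro allI impI)
  fix r v assume "r < k"
  hence "\<forall>i\<in>S. \<exists>B. \<forall>u. T i (v(r := u)) = (\<Sum>s<D. u s * B s)"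
    using assms unfolding row_linear_def by blast
  then obtain B where "\<forall>i\<in>S. \<forall>u. T i (v(r := u)) = (\<Sum>s<D. u s * B i s)"
    by metis
  hence "(\<Sum>i\<in>S. T i (v(r := u))) = (\<Sum>s<D. u s * (\<Sum>i\<in>S. B i s))" for u
    by (simp add: sum_distrib_left) (rule sum.swap)
  thus "\<exists>B. \<forall>u. (\<Sum>i\<in>S. T i (v(r := u))) = (\<Sum>s<D. u s * B s)" by (intro exI allI)
qed

lemma row_linear_scale:
  assumes "row_linear D k T"
  shows "row_linear D k (\<lambda>v. a * T v)"
  unfolding row_linear_def
proof (intro allI impI)
  fix r v assume "r < k"
  then obtain B where "\<forall>u. T (v(r := u)) = (\<Sum>s<D. u s * B s)"
    using assms unfolding row_linear_def by blast
  hence "a * T (v(r := u)) = (\<Sum>s<D. u s * (a * B s))" for u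
    by (simp add: sum_distrib_left mult_ac)
  thus "\<exists>B. \<forall>u. a * T (v(r := u)) = (\<Sum>s<D. u s * B s)" by (intro exI allI)
qed

lemma row_linear_diff:
  assumes "row_linear D k T" "row_linear D k T'"
  shows "row_linear D k (\<lambda>v. T v - T' v)"
  unfolding row_linear_def
proof (intro allI impI)
  fix r v assume "r < k"
  then obtain B B' where "\<forall>u. T (v(r := u)) = (\<Sum>s<D. u s * B s)"
      "\<forall>u. T' (v(r := u)) = (\<Sum>s<D. u s * B' s)"
    using assms unfolding row_linear_def by blast
  hence "T (v(r := u)) - T' (v(r := u)) = (\<Sum>s<D. u s * (B s - B' s))" for u
    by (simp add: right_diff_distrib sum_subtractf)
  thus "\<exists>B. \<forall>u. T (v(r := u)) - T' (v(r := u)) = (\<Sum>s<D. u s * B s)" by (intro exI allI)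
qed

lemma row_linear_creation_diff:
  "row_linear (card A + k) k (\<lambda>v. creation_form t x A k v - determinant_form t x A k v)"
  unfolding creation_form_def determinant_form_def
  by (intro row_linear_diff row_linear_sum row_linear_scale row_linear_det)

text \<open>The \<open>B s\<close> are the coefficients of a polynomial of degree below
  \<open>D\<close> with at least \<open>D\<close> zeros.\<close>

lemma coefficients_zero:
  fixes B :: "nat \<Rightarrow> 'a :: field"
  assumes "D \<le> card Y" "\<And>y. y \<in> Y \<Longrightarrow> (\<Sum>s<D. y ^ s * B s) = 0" "s < D"
  shows "B s = 0"
proof -
  define p where "p = (\<Sum>s<D. monom (B s) s)"
  have c: "coeff p i = (if i < D then B i else 0)" for i
    by (simp add: p_def coeff_sum)
  have "degree p < D"
    using assms(3) by (cases "p = 0") (auto simp: c intro!: degree_lessI)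
  hence "p = 0"
    using assms by (intro poly_eqI_degree[of Y]) (auto simp: p_def poly_sum poly_monom mult.commute)
  thus ?thesis using c[of s] assms(3) by simp
qed

text \<open>In the application \<open>F\<close> consists of 0 and the poles
  \<open>t * x a\<close>.\<close>

definition generic :: "'a set \<Rightarrow> nat \<Rightarrow> (nat \<Rightarrow> 'a) \<Rightarrow> bool" where
  "generic F k w \<longleftrightarrow> inj_on w {..<k} \<and> w ` {..<k} \<inter> F = {}"

lemma generic_exists:
  assumes "infinite (UNIV :: 'a set)" "finite (F :: 'a set)"
  obtains w where "generic F k w"
proof -
  have "infinite (- F)" using assms by (simp add: Compl_eq_Diff_UNIV)
  then obtain Y where Y: "Y \<subseteq> - F" "finite Y" "card Y = k"
    using infinite_arbitrarily_large by blast
  obtain w where "bij_betw w {..<k} Y"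
    using ex_bij_betw_nat_finite[OF Y(2)] Y(3) by (auto simp: atLeast0LessThan)
  hence "generic F k w"
    using Y by (auto simp: generic_def bij_betw_def)
  thus thesis by (rule that)
qed

text \<open>Evaluations are replaced by arbitrary functionals one row at a time: in
  \<open>partial\<close> the first \<open>l\<close> rows are already arbitrary. With the other rows
  fixed, evaluating row \<open>l\<close> at \<open>y\<close> gives a polynomial in \<open>y\<close>
  of degree below \<open>D\<close>. It vanishes at \<open>D\<close> new generic points, so all its
  coefficients \<open>B s\<close> vanish, and then every functional in row \<open>l\<close> gives
  zero.\<close>

lemma row_linear_zero_extend:
  fixes T :: "(nat \<Rightarrow> nat \<Rightarrow> 'a :: field_char_0) \<Rightarrow> 'a"
  assumes lin: "row_linear D k T" and F: "finite F"
    and cong: "\<And>v v'. (\<And>r. r < k \<Longrightarrow> v r = v' r) \<Longrightarrow> T v = T v'"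
    and zero: "\<And>w. generic F k w \<Longrightarrow> T (\<lambda>r s. w r ^ s) = 0"
  shows "T v = 0"
proof -
  have partial: "T (\<lambda>r. if r < l then v r else (\<lambda>s. w r ^ s)) = 0"
    if "l \<le> k" "generic F k w" for l w
    using that
  proof (induction l arbitrary: w)
    case (Suc l)
    define b where "b = (\<lambda>r. if r < l then v r else (\<lambda>s. w r ^ s))"
    obtain B where B: "\<And>u. T (b(l := u)) = (\<Sum>s<D. u s * B s)"
      using lin Suc.prems unfolding row_linear_def by (meson Suc_le_lessD)
    \<comment> \<open>Besides \<open>F\<close> the points already in use are avoided, so that
      replacing \<open>w l\<close> by a new point keeps the tuple generic.\<close>
    define Z where "Z = F \<union> w ` {..<k}"
    have "infinite (- Z)"
      using F by (simp add: Z_def Compl_eq_Diff_UNIV infinite_UNIV_char_0)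
    then obtain Y where Y: "Y \<subseteq> - Z" "finite Y" "card Y = D"
      using infinite_arbitrarily_large by blast
    have "(\<Sum>s<D. y ^ s * B s) = 0" if "y \<in> Y" for y
    proof -
      have y: "y \<notin> F" "y \<notin> w ` {..<k}" using that Y by (auto simp: Z_def)
      have gen: "generic F k (w(l := y))"
        using Suc.prems y unfolding generic_def
        by (auto simp: inj_on_def)
      have "(\<lambda>r. if r < l then v r else (\<lambda>s. (w(l := y)) r ^ s)) = b(l := (\<lambda>s. y ^ s))"
        by (auto simp: b_def fun_eq_iff)
      thus ?thesis
        using Suc.IH[OF _ gen] Suc.prems B[of "\<lambda>s. y ^ s"] by simp
    qed
    hence "B s = 0" if "s < D" for s
      using coefficients_zero[of D Y B s] Y that by simp
    hence "T (b(l := v l)) = 0" by (simp add: B)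
    moreover have "(\<lambda>r. if r < Suc l then v r else (\<lambda>s. w r ^ s)) = b(l := v l)"
      by (auto simp: b_def fun_eq_iff less_Suc_eq)
    ultimately show ?case by simp
  qed (use zero in simp)
  obtain w where "generic F k w"
    using generic_exists[OF infinite_UNIV_char_0 F] .
  from partial[OF order.refl this] show ?thesis
    by (subst cong[of _ "\<lambda>r. if r < k then v r else (\<lambda>s. w r ^ s)"]) auto
qed

section \<open>The identity at generic points\<close>

lemma shift_poly_insert_both:
  assumes "a \<notin> A" "finite A" "J \<subseteq> A"
  shows "poly (shift_poly t x (insert a A) (insert a J)) z = (z - x a) * poly (shift_poly t x A J) z"
proof -
  have "insert a A - insert a J = A - J" "a \<notin> J" "finite J"
    using assms finite_subset by auto
  thus ?thesis by (simp add: poly_shift_poly)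
qed

lemma shift_poly_insert:
  assumes "a \<notin> A" "finite A" "J \<subseteq> A"
  shows "poly (shift_poly t x (insert a A) J) z = (z - t * x a) * poly (shift_poly t x A J) z"
proof -
  have "insert a A - J = insert a (A - J)" "a \<notin> A - J"
    using assms by auto
  thus ?thesis using assms(2) by (simp add: poly_shift_poly)
qed

lemma det_zero_row:
  assumes "r0 < k" "\<And>c. c < k \<Longrightarrow> f r0 c = 0"
  shows "det (mat k k (\<lambda>(r, c). f r c)) = 0"
proof -
  have "det (mat k k (\<lambda>(r, c). f r c)) = (\<Sum>c<k. mat k k (\<lambda>(r, c). f r c) $$ (r0, c) *
      cofactor (mat k k (\<lambda>(r, c). f r c)) r0 c)"
    by (rule laplace_expansion_row) (use assms in auto)
  also have "\<dots> = 0"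
    using assms by (intro sum.neutral) auto
  finally show ?thesis .
qed

lemma det_equal_rows:
  assumes "r1 < k" "r2 < k" "r1 \<noteq> r2" "\<And>c. c < k \<Longrightarrow> f r1 c = f r2 c"
  shows "det (mat k k (\<lambda>(r, c). f r c)) = 0"
proof (rule det_identical_rows[of _ k r1 r2])
  show "row (mat k k (\<lambda>(r, c). f r c)) r1 = row (mat k k (\<lambda>(r, c). f r c)) r2"
    by (rule eq_vecI) (use assms in auto)
qed (use assms in auto)

text \<open>At \<open>w 0 = t * x a\<close> the first polynomial in row 0 vanishes. In the remaining
  term the powers of \<open>t\<close> from \<open>w 0 ^ Suc c\<close> and from the column combine to
  \<open>t ^ Suc k\<close>, so row 0 is a multiple of the powers of \<open>x a\<close> and
  \<open>det_geometric_row\<close> applies with \<open>y = x a\<close>.\<close>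

lemma determinant_eval_residue:
  fixes x :: "'i \<Rightarrow> 'a :: field"
  assumes A: "a \<notin> A" "finite A" and w0: "w 0 = t * x a"
  shows "determinant_eval t x (insert a A) (Suc k) w =
    - (t ^ Suc k) * x a * poly (shift_poly t x (insert a A) (insert a A)) (t * x a) *
    (\<Prod>r<k. (w (Suc r) - x a) * (w (Suc r) - t * x a)) * determinant_eval t x A k (w \<circ> Suc)"
proof -
  let ?Q = "\<lambda>z. poly (shift_poly t x (insert a A) {}) z"
  let ?R = "\<lambda>z. poly (shift_poly t x (insert a A) (insert a A)) z"
  define \<alpha> where "\<alpha> = - (t ^ Suc k) * x a * ?R (t * x a)"
  define f where "f r c = (if r = 0 then x a ^ c else
      w r ^ Suc c * (?Q (w r) - t ^ (Suc k - Suc c) * ?R (w r)))" for r c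
  have "?Q (t * x a) = 0"
    using shift_poly_insert[OF A, of "{}" t x] by simp
  hence "determinant_eval t x (insert a A) (Suc k) w =
      det (mat (Suc k) (Suc k) (\<lambda>(r, c). (if r = 0 then \<alpha> else 1) * f r c))"
    unfolding determinant_eval_def
  proof (intro det_mat_cong)
    fix r c assume Q: "?Q (t * x a) = 0" and "r < Suc k" and c: "c < Suc k"
    have "t ^ Suc c * t ^ (Suc k - Suc c) = t ^ Suc k"
      using c by (simp only: power_add[symmetric] le_add_diff_inverse Suc_leI)
    moreover have "w 0 ^ Suc c * (?Q (w 0) - t ^ (Suc k - Suc c) * ?R (w 0)) =
        - (t ^ Suc c * t ^ (Suc k - Suc c)) * x a * ?R (t * x a) * x a ^ c"
      by (simp add: w0 Q power_mult_distrib mult_ac)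
    ultimately show "w r ^ Suc c * (?Q (w r) - t ^ (Suc k - Suc c) * ?R (w r)) =
        (if r = 0 then \<alpha> else 1) * f r c"
      by (cases "r = 0") (simp_all only: f_def \<alpha>_def simp_thms if_True if_False mult_1)
  qed
  also have "\<dots> = \<alpha> * det (mat (Suc k) (Suc k) (\<lambda>(r, c). f r c))"
    unfolding det_scale_rows by (simp add: prod.lessThan_Suc_shift del: prod.lessThan_Suc)
  also have "det (mat (Suc k) (Suc k) (\<lambda>(r, c). f r c)) =
      det (mat k k (\<lambda>(r, c). f (Suc r) (Suc c) - x a * f (Suc r) c))"
    by (rule det_geometric_row) (simp add: f_def)
  also have "\<dots> = det (mat k k (\<lambda>(r, c). ((w (Suc r) - x a) * (w (Suc r) - t * x a)) *
      ((w \<circ> Suc) r ^ Suc c * (poly (shift_poly t x A {}) ((w \<circ> Suc) r) -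
        t ^ (k - Suc c) * poly (shift_poly t x A A) ((w \<circ> Suc) r)))))"
  proof (rule det_mat_cong)
    fix r c assume "r < k" "c < k"
    \<comment> \<open>This extra \<open>t\<close> makes the column operation produce
      \<open>w - t * x a\<close> on the second polynomial, which already has the factor
      \<open>w - x a\<close>; on the first polynomial the roles are exchanged. Hence both terms
      share the product of the two factors.\<close>
    hence "t ^ (k - c) = t * t ^ (k - Suc c)"
      by (simp add: Suc_diff_Suc flip: power_Suc)
    thus "f (Suc r) (Suc c) - x a * f (Suc r) c = ((w (Suc r) - x a) * (w (Suc r) - t * x a)) *
      ((w \<circ> Suc) r ^ Suc c * (poly (shift_poly t x A {}) ((w \<circ> Suc) r) -
        t ^ (k - Suc c) * poly (shift_poly t x A A) ((w \<circ> Suc) r)))"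
      by (simp add: f_def shift_poly_insert[OF A] shift_poly_insert_both[OF A] algebra_simps)
  qed
  finally show ?thesis
    unfolding det_scale_rows determinant_eval_def \<alpha>_def by (simp only: mult.assoc)
qed

text \<open>All factors that involve \<open>a\<close> are collected. An index \<open>j\<close>
  contributes \<open>t * x a - x j\<close> in every case, with an additional \<open>t\<close> when
  \<open>j\<close> lies in \<open>J\<close> (from the binomial exponent) or in \<open>I - J\<close>
  (from the numerator \<open>t * x a - t * x j\<close>). The total power
  \<open>t ^ card I = t ^ k\<close> and the product over \<open>A\<close> no longer depend on
  \<open>I\<close> and \<open>J\<close>.\<close>

lemma choice_crossing_residue:
  fixes x :: "'i \<Rightarrow> 'a :: field"
  assumes A: "a \<notin> A" "finite A" and t: "t \<noteq> 0" and inj: "inj_on x (insert a A)"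
    and I: "I \<subseteq> A" "card I = k" and J: "J \<subseteq> I"
  shows "choice_weight t x (insert a A) (insert a I) *
      ((- t) ^ card (insert a J) * crossing_weight t x (insert a I) (insert a J) *
        poly (shift_poly t x (insert a A) (insert a J)) (t * x a)) =
    - (t ^ Suc k) * x a * poly (shift_poly t x (insert a A) (insert a A)) (t * x a) *
      (choice_weight t x A I * ((- t) ^ card J * crossing_weight t x I J))"
proof -
  have fin: "finite I" "finite J" "a \<notin> I" "a \<notin> J"
    using finite_subset[OF I(1) A(2)] finite_subset[OF J] I(1) J A(1) by auto
  have D: "insert a A - insert a I = A - I" "insert a I - insert a J = I - J"
    using A fin by auto
  have cardJ: "card (insert a J) = Suc (card J)" using fin by simp
  have ne: "x a - x j \<noteq> 0" if "j \<in> A" for j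
    using that A inj_onD[OF inj, of a j] by auto
  have cw: "choice_weight t x (insert a A) (insert a I) = x a * choice_weight t x A I *
      (\<Prod>j\<in>A - I. (x a - x j / t) / (x a - x j))"
    unfolding choice_weight_def D using fin by (simp add: mult_ac)
  have cr: "crossing_weight t x (insert a I) (insert a J) = t ^ card J * crossing_weight t x I J *
      (\<Prod>j\<in>I - J. (t * x a - x j) / (x a - x j))"
    unfolding crossing_weight_def D cardJ using fin by (simp add: numeral_2_eq_2 power_add mult_ac)
  have sub2: "(\<Prod>j\<in>A - J. f j) = (\<Prod>j\<in>I - J. f j) * (\<Prod>j\<in>A - I. f j)" for f :: "'i \<Rightarrow> 'a"
  proof -
    have "A - J - (I - J) = A - I" using J by auto
    moreover have "I - J \<subseteq> A - J" using I(1) by auto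
    ultimately show ?thesis
      using prod.subset_diff[of "I - J" "A - J" f] A(2) by (simp add: mult.commute)
  qed
  have sub1: "(\<Prod>j\<in>A. f j) = (\<Prod>j\<in>J. f j) * (\<Prod>j\<in>I - J. f j) * (\<Prod>j\<in>A - I. f j)"
    for f :: "'i \<Rightarrow> 'a"
    unfolding prod.subset_diff[OF I(1) A(2)] prod.subset_diff[OF J fin(1)] by (simp only: mult_ac)
  have out: "(\<Prod>j\<in>A - I. (x a - x j / t) / (x a - x j)) * (\<Prod>j\<in>A - I. t * x a - t * x j) =
      (\<Prod>j\<in>A - I. t * x a - x j)"
    unfolding prod.distrib[symmetric] using ne t by (intro prod.cong) (auto simp: field_simps)
  have mid: "(\<Prod>j\<in>I - J. (t * x a - x j) / (x a - x j)) * (\<Prod>j\<in>I - J. t * x a - t * x j) =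
      t ^ card (I - J) * (\<Prod>j\<in>I - J. t * x a - x j)"
    unfolding prod.distrib[symmetric] prod_constant[symmetric]
    using ne t I by (intro prod.cong) (auto simp: field_simps)
  have tk: "t ^ card J * t ^ card (I - J) = t ^ k"
    using card_Diff_subset[OF fin(2) J] card_mono[OF fin(1) J] I(2) by (simp flip: power_add)
  have JA: "J \<subseteq> A" using I J by auto
  define M where "M = (\<Prod>j\<in>I - J. (t * x a - x j) / (x a - x j))"
  define O' where "O' = (\<Prod>j\<in>A - I. (x a - x j / t) / (x a - x j))"
  have "choice_weight t x (insert a A) (insert a I) *
      ((- t) ^ card (insert a J) * crossing_weight t x (insert a I) (insert a J) *
        poly (shift_poly t x (insert a A) (insert a J)) (t * x a)) =
    - t * x a * (t * x a - x a) * t ^ card J * (\<Prod>j\<in>J. t * x a - x j) *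
      (M * (\<Prod>j\<in>I - J. t * x a - t * x j)) * (O' * (\<Prod>j\<in>A - I. t * x a - t * x j)) *
      (choice_weight t x A I * ((- t) ^ card J * crossing_weight t x I J))"
    unfolding cw cr cardJ shift_poly_insert_both[OF A JA]
    unfolding poly_shift_poly sub2 M_def O'_def
    by (simp add: mult_ac)
  also have "\<dots> = - t * x a * (t * x a - x a) * (t ^ card J * t ^ card (I - J)) *
      ((\<Prod>j\<in>J. t * x a - x j) * (\<Prod>j\<in>I - J. t * x a - x j) * (\<Prod>j\<in>A - I. t * x a - x j)) *
      (choice_weight t x A I * ((- t) ^ card J * crossing_weight t x I J))"
    unfolding M_def O'_def out mid by (simp only: mult_ac)
  also have "\<dots> = - (t ^ Suc k) * x a * poly (shift_poly t x (insert a A) (insert a A)) (t * x a) *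
      (choice_weight t x A I * ((- t) ^ card J * crossing_weight t x I J))"
    unfolding tk shift_poly_insert_both[OF A order.refl]
    unfolding poly_shift_poly sub1[symmetric]
    by (simp add: mult_ac)
  finally show ?thesis .
qed

text \<open>At \<open>w\<^sub>0 = t x\<^sub>a\<close> only the terms with \<open>a \<in> J \<subseteq> I\<close> survive.\<close>

lemma creation_eval_residue:
  fixes x :: "'i \<Rightarrow> 'a :: field"
  assumes A: "a \<notin> A" "finite A" and t: "t \<noteq> 0" and inj: "inj_on x (insert a A)"
    and w0: "w 0 = t * x a"
  shows "creation_eval t x (insert a A) (Suc k) w =
    - (t ^ Suc k) * x a * poly (shift_poly t x (insert a A) (insert a A)) (t * x a) *
    (\<Prod>r<k. (w (Suc r) - x a) * (w (Suc r) - t * x a)) * creation_eval t x A k (w \<circ> Suc)"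
proof -
  define \<alpha> where "\<alpha> = - (t ^ Suc k) * x a * poly (shift_poly t x (insert a A) (insert a A)) (t * x a)"
  let ?N = "\<lambda>J z. poly (shift_poly t x (insert a A) J) z"
  define V where "V = det (mat (Suc k) (Suc k) (\<lambda>(r, c). w r ^ c))"
  define V' where "V' = det (mat k k (\<lambda>(r, c). (w \<circ> Suc) r ^ c))"
  \<comment> \<open>Row 0 of the Vandermonde matrix consists of the powers of
    \<open>t * x a\<close>; its differences with the other points split off.\<close>
  have V: "V = (\<Prod>r<k. w (Suc r) - t * x a) * V'"
  proof -
    have "V = det (mat k k (\<lambda>(r, c). (w (Suc r) - t * x a) * (w \<circ> Suc) r ^ c))"
      unfolding V_def by (subst det_geometric_row[where y = "t * x a"])
        (auto simp: w0 algebra_simps intro!: det_mat_cong)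
    thus ?thesis by (simp only: det_scale_rows V'_def)
  qed
  define g where "g I J = choice_weight t x (insert a A) I *
      ((- t) ^ card J * crossing_weight t x I J * ((\<Prod>r<Suc k. ?N J (w r)) * V))" for I J
  define h where "h I J = choice_weight t x A I * ((- t) ^ card J * crossing_weight t x I J *
      ((\<Prod>r<k. poly (shift_poly t x A J) ((w \<circ> Suc) r)) * V'))" for I J
  have zero: "g I J = 0" if "J \<subseteq> insert a A" "a \<notin> J" for I J
  proof -
    have "J \<subseteq> A" using that by auto
    hence "?N J (w 0) = 0" by (simp add: shift_poly_insert[OF A] w0)
    thus ?thesis by (simp add: g_def prod.lessThan_Suc_shift del: prod.lessThan_Suc)
  qed
  have step: "g (insert a I) (insert a J) =
      \<alpha> * (\<Prod>r<k. (w (Suc r) - x a) * (w (Suc r) - t * x a)) * h I J"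
    if I: "I \<subseteq> A" "card I = k" and J: "J \<subseteq> I" for I J
  proof -
    have JA: "J \<subseteq> A" using I J by auto
    have "g (insert a I) (insert a J) = (choice_weight t x (insert a A) (insert a I) *
      ((- t) ^ card (insert a J) * crossing_weight t x (insert a I) (insert a J) *
        ?N (insert a J) (t * x a))) * ((\<Prod>r<k. ?N (insert a J) (w (Suc r))) * V)"
      unfolding g_def prod.lessThan_Suc_shift w0 by (simp only: mult_ac)
    also have "\<dots> = \<alpha> * (\<Prod>r<k. (w (Suc r) - x a) * (w (Suc r) - t * x a)) * h I J"
      unfolding choice_crossing_residue[OF A t inj I J]
      unfolding shift_poly_insert_both[OF A JA] h_def V prod.distrib \<alpha>_def
      by (simp add: mult_ac)
    finally show ?thesis .
  qed
  have inner: "(\<Sum>J\<in>Pow (insert a I). g (insert a I) J) = (\<Sum>J\<in>Pow I. g (insert a I) (insert a J))"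
    if I: "I \<subseteq> A" for I
  proof -
    have aI: "a \<notin> I" and fin: "finite I" using I A finite_subset by auto
    have "(\<Sum>J\<in>Pow (insert a I). g (insert a I) J) = (\<Sum>J\<in>insert a ` Pow I. g (insert a I) J)"
      using fin I by (intro sum.mono_neutral_right)
        (auto simp: Pow_insert intro!: zero)
    also have "\<dots> = (\<Sum>J\<in>Pow I. g (insert a I) (insert a J))"
      using aI by (subst sum.reindex) (auto simp: inj_on_def insert_ident)
    finally show ?thesis .
  qed
  have "creation_eval t x (insert a A) (Suc k) w =
      (\<Sum>I | I \<subseteq> insert a A \<and> card I = Suc k. \<Sum>J\<in>Pow I. g I J)"
    unfolding creation_eval_def g_def V_def by (simp only: sum_distrib_left)
  also have "\<dots> = (\<Sum>I\<in>insert a ` {I. I \<subseteq> A \<and> card I = k}. \<Sum>J\<in>Pow I. g I J)"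
  proof (rule sum.mono_neutral_right)
    show "insert a ` {I. I \<subseteq> A \<and> card I = k} \<subseteq> {I. I \<subseteq> insert a A \<and> card I = Suc k}"
      using A by (auto intro!: card_insert_disjoint dest: finite_subset)
    show "\<forall>I\<in>{I. I \<subseteq> insert a A \<and> card I = Suc k} - insert a ` {I. I \<subseteq> A \<and> card I = k}.
        (\<Sum>J\<in>Pow I. g I J) = 0"
    proof
      fix I assume I: "I \<in> {I. I \<subseteq> insert a A \<and> card I = Suc k} - insert a ` {I. I \<subseteq> A \<and> card I = k}"
      have "a \<notin> I"
      proof
        assume "a \<in> I"
        moreover have "finite I" using I A finite_subset[of I "insert a A"] by auto
        ultimately have "I = insert a (I - {a})" "I - {a} \<subseteq> A" "card (I - {a}) = k"
          using I by auto
        thus False using I by blast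
      qed
      thus "(\<Sum>J\<in>Pow I. g I J) = 0"
        using I by (intro sum.neutral ballI zero) auto
    qed
  qed (use A in simp)
  also have "\<dots> = (\<Sum>I | I \<subseteq> A \<and> card I = k. \<Sum>J\<in>Pow (insert a I). g (insert a I) J)"
    using A(1) by (subst sum.reindex) (auto intro!: inj_onI simp: insert_ident set_eq_iff)
  also have "\<dots> = (\<Sum>I | I \<subseteq> A \<and> card I = k. \<Sum>J\<in>Pow I.
      \<alpha> * (\<Prod>r<k. (w (Suc r) - x a) * (w (Suc r) - t * x a)) * h I J)"
  proof (rule sum.cong[OF refl])
    fix I assume "I \<in> {I. I \<subseteq> A \<and> card I = k}"
    thus "(\<Sum>J\<in>Pow (insert a I). g (insert a I) J) = (\<Sum>J\<in>Pow I.
        \<alpha> * (\<Prod>r<k. (w (Suc r) - x a) * (w (Suc r) - t * x a)) * h I J)"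
      using inner[of I] step[of I] by simp
  qed
  also have "\<dots> = \<alpha> * (\<Prod>r<k. (w (Suc r) - x a) * (w (Suc r) - t * x a)) *
      creation_eval t x A k (w \<circ> Suc)"
    unfolding creation_eval_def h_def V'_def by (simp only: sum_distrib_left)
  finally show ?thesis by (simp only: \<alpha>_def)
qed

text \<open>Row 0 contributes the value of the numerator at 0, and together with
  \<open>(- t) ^ card J\<close> this is \<open>(-1) ^ card J\<close> times a product independent of
  \<open>J\<close>. Exchanging the products over rows and letters turns the other rows into values
  of one polynomial \<open>P\<close>, so the sum over \<open>J\<close> vanishes by
  \<open>crossing_sum_zero\<close> for each \<open>I\<close> separately.\<close>

lemma creation_eval_zero:
  fixes x :: "'i \<Rightarrow> 'a :: field"
  assumes A: "finite A" and inj: "inj_on x A" and w0: "w 0 = 0"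
  shows "creation_eval t x A (Suc k) w = 0"
proof -
  \<comment> \<open>Only the \<open>k\<close> remaining points enter, so the degree \<open>k\<close>
    lies below \<open>card I = Suc k\<close>.\<close>
  define P where "P = (\<Prod>r<k. [:w (Suc r), - 1:])"
  have P: "poly P z = (\<Prod>r<k. w (Suc r) - z)" for z
    by (simp add: P_def poly_prod)
  have P0: "P \<noteq> 0" by (simp add: P_def)
  have degP: "degree P < Suc k"
    by (simp add: P_def degree_prod_eq_sum_degree)
  define V where "V = det (mat (Suc k) (Suc k) (\<lambda>(r, c). w r ^ c))"
  have "(\<Sum>J\<in>Pow I. (- t) ^ card J * crossing_weight t x I J *
      ((\<Prod>r<Suc k. poly (shift_poly t x A J) (w r)) * V)) = 0"
    if I: "I \<subseteq> A" "card I = Suc k" for I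
  proof -
    have finI: "finite I" using I A finite_subset by blast
    have "(\<Sum>J\<in>Pow I. (- t) ^ card J * crossing_weight t x I J *
        ((\<Prod>r<Suc k. poly (shift_poly t x A J) (w r)) * V)) =
      (\<Sum>J\<in>Pow I. ((-1) ^ card J * crossing_weight t x I J *
         (\<Prod>i\<in>J. poly P (x i)) * (\<Prod>i\<in>I - J. poly P (t * x i))) *
         ((\<Prod>j\<in>A. - (t * x j)) * (\<Prod>j\<in>A - I. poly P (t * x j)) * V))"
    proof (intro sum.cong refl)
      fix J assume "J \<in> Pow I"
      hence J: "J \<subseteq> I" "J \<subseteq> A" "finite J" using I finI finite_subset by auto
      have split: "(\<Prod>j\<in>A - J. f j) = (\<Prod>j\<in>I - J. f j) * (\<Prod>j\<in>A - I. f j)" for f :: "'i \<Rightarrow> 'a"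
      proof -
        have "A - J - (I - J) = A - I" using J by auto
        thus ?thesis
          using prod.subset_diff[of "I - J" "A - J" f] I A by (auto simp: mult.commute)
      qed
      have "(\<Prod>r<Suc k. poly (shift_poly t x A J) (w r)) =
          poly (shift_poly t x A J) 0 * (\<Prod>r<k. poly (shift_poly t x A J) (w (Suc r)))"
        unfolding prod.lessThan_Suc_shift w0 ..
      also have "(\<Prod>r<k. poly (shift_poly t x A J) (w (Suc r))) =
          (\<Prod>j\<in>J. poly P (x j)) * (\<Prod>j\<in>A - J. poly P (t * x j))"
        unfolding poly_shift_poly prod.distrib P
        by (intro arg_cong2[of _ _ _ _ "(*)"] prod.swap)
      finally have prod: "(\<Prod>r<Suc k. poly (shift_poly t x A J) (w r)) =
          poly (shift_poly t x A J) 0 *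
          ((\<Prod>j\<in>J. poly P (x j)) * ((\<Prod>j\<in>I - J. poly P (t * x j)) * (\<Prod>j\<in>A - I. poly P (t * x j))))"
        by (simp only: split)
      have "(- t) ^ card J * poly (shift_poly t x A J) 0 =
          (\<Prod>j\<in>J. (- t) * (0 - x j)) * (\<Prod>j\<in>A - J. 0 - t * x j)"
        unfolding poly_shift_poly by (simp only: prod.distrib prod_constant mult.assoc)
      also have "(\<Prod>j\<in>J. (- t) * (0 - x j)) = (\<Prod>j\<in>J. (- 1) * - (t * x j))"
        by simp
      also have "\<dots> * (\<Prod>j\<in>A - J. 0 - t * x j) =
          (-1) ^ card J * ((\<Prod>j\<in>A - J. - (t * x j)) * (\<Prod>j\<in>J. - (t * x j)))"
        unfolding prod.distrib prod_constant by (simp add: mult_ac)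
      also have "(\<Prod>j\<in>A - J. - (t * x j)) * (\<Prod>j\<in>J. - (t * x j)) = (\<Prod>j\<in>A. - (t * x j))"
        by (rule prod.subset_diff[OF J(2) A, symmetric])
      finally have sign: "(- t) ^ card J * poly (shift_poly t x A J) 0 =
          (-1) ^ card J * (\<Prod>j\<in>A. - (t * x j))" .
      have "(- t) ^ card J * crossing_weight t x I J *
          ((\<Prod>r<Suc k. poly (shift_poly t x A J) (w r)) * V) =
        ((- t) ^ card J * poly (shift_poly t x A J) 0) * crossing_weight t x I J *
          ((\<Prod>j\<in>J. poly P (x j)) * ((\<Prod>j\<in>I - J. poly P (t * x j)) *
            (\<Prod>j\<in>A - I. poly P (t * x j)))) * V"
        unfolding prod by (simp only: mult_ac)
      also have "\<dots> = ((-1) ^ card J * crossing_weight t x I J *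
         (\<Prod>i\<in>J. poly P (x i)) * (\<Prod>i\<in>I - J. poly P (t * x i))) *
         ((\<Prod>j\<in>A. - (t * x j)) * (\<Prod>j\<in>A - I. poly P (t * x j)) * V)"
        unfolding sign by (simp only: mult_ac)
      finally show "(- t) ^ card J * crossing_weight t x I J *
          ((\<Prod>r<Suc k. poly (shift_poly t x A J) (w r)) * V) = \<dots>" .
    qed
    also have "\<dots> = 0"
      unfolding sum_distrib_right[symmetric]
      by (subst crossing_sum_zero[OF finI])
        (use degP P0 I inj in \<open>auto intro: inj_on_subset\<close>)
    finally show ?thesis .
  qed
  thus ?thesis
    unfolding creation_eval_def V_def[symmetric] by (intro sum.neutral) auto
qed

lemma creation_eval_eq:
  fixes x :: "'i \<Rightarrow> 'a :: field_char_0"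
  assumes "finite A" "inj_on x A" "0 \<notin> x ` A" "t \<noteq> 0"
    and "generic (insert 0 ((\<lambda>a. t * x a) ` A)) k w"
  shows "creation_eval t x A k w = determinant_eval t x A k w"
  using assms
proof (induction k arbitrary: A w)
  case 0
  have "{I. I \<subseteq> A \<and> card I = 0} = {{}}"
    using 0(1) by (auto dest: finite_subset simp: card_eq_0_iff)
  thus ?case
    by (simp add: creation_eval_def determinant_eval_def choice_weight_def crossing_weight_def
        numeral_2_eq_2)
next
  case (Suc k)
  \<comment> \<open>Linearity in row 0 supplies the degree bound: with the other rows fixed, the
    difference of the two evaluations is a polynomial in \<open>w 0\<close> of degree below
    \<open>D\<close>, with coefficients \<open>B s\<close>.\<close>
  define T where "T v = creation_form t x A (Suc k) v - determinant_form t x A (Suc k) v" for v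
  have T: "T (\<lambda>r s. w r ^ s) = creation_eval t x A (Suc k) w - determinant_eval t x A (Suc k) w" for w
    by (simp add: T_def creation_form_powers determinant_form_powers Suc.prems)
  define D where "D = card A + Suc k"
  have "row_linear D (Suc k) T"
    unfolding T_def D_def by (rule row_linear_creation_diff)
  then obtain B where B: "\<And>u. T ((\<lambda>r s. w r ^ s)(0 := u)) = (\<Sum>s<D. u s * B s)"
    unfolding row_linear_def by (meson zero_less_Suc)
  \<comment> \<open>These are \<open>1 + card A + k = D\<close> points; the hypotheses on
    \<open>x\<close> and \<open>t\<close> and the genericity of \<open>w\<close> make them
    distinct.\<close>
  define Y where "Y = insert 0 ((\<lambda>a. t * x a) ` A) \<union> w ` {1..k}"
  have "card Y = D"
  proof -
    have gen: "inj_on w {..<Suc k}" "w ` {..<Suc k} \<inter> insert 0 ((\<lambda>a. t * x a) ` A) = {}"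
      using Suc.prems(5) by (auto simp: generic_def)
    have "card (w ` {1..k}) = k"
      using inj_on_subset[OF gen(1), of "{1..k}"] by (simp add: card_image subset_iff)
    moreover have "card (insert 0 ((\<lambda>a. t * x a) ` A)) = Suc (card A)"
    proof -
      have "inj_on (\<lambda>a. t * x a) A"
        using Suc.prems(2,4) by (auto simp: inj_on_def)
      moreover have "0 \<notin> (\<lambda>a. t * x a) ` A"
        using Suc.prems(3,4) by auto
      ultimately show ?thesis using Suc.prems(1) by (simp add: card_image)
    qed
    moreover have "w ` {1..k} \<subseteq> w ` {..<Suc k}" by auto
    hence "insert 0 ((\<lambda>a. t * x a) ` A) \<inter> w ` {1..k} = {}" using gen(2) by blast
    ultimately show ?thesis
      unfolding Y_def D_def using Suc.prems(1) by (subst card_Un_disjoint) auto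
  qed
  moreover have "(\<Sum>s<D. y ^ s * B s) = 0" if y: "y \<in> Y" for y
  proof -
    define w' where "w' = w(0 := y)"
    have w0: "w' 0 = y" and wS: "w' \<circ> Suc = w \<circ> Suc" by (auto simp: w'_def)
    have "(\<lambda>r s. w r ^ s)(0 := (\<lambda>s. y ^ s)) = (\<lambda>r s. w' r ^ s)"
      by (auto simp: w'_def fun_eq_iff)
    hence "(\<Sum>s<D. y ^ s * B s) = creation_eval t x A (Suc k) w' - determinant_eval t x A (Suc k) w'"
      using B[of "\<lambda>s. y ^ s"] T[of w'] by simp
    moreover from y consider "y = 0" | a where "a \<in> A" "y = t * x a"
      | r where "1 \<le> r" "r \<le> k" "y = w r"
      by (auto simp: Y_def)
    hence "creation_eval t x A (Suc k) w' = determinant_eval t x A (Suc k) w'"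
    proof cases
      case 1
      have "determinant_eval t x A (Suc k) w' = 0"
        unfolding determinant_eval_def by (rule det_zero_row[of 0]) (simp_all add: w0 1)
      thus ?thesis using creation_eval_zero[OF Suc.prems(1,2), of w'] w0 1 by simp
    next
      case 2
      \<comment> \<open>Both residue lemmas yield the same prefactor, and the remaining points
        \<open>w \<circ> Suc\<close> are generic for the smaller set, so the induction hypothesis
        closes this case.\<close>
      define A' where "A' = A - {a}"
      have A: "A = insert a A'" "a \<notin> A'" "finite A'" using 2 Suc.prems(1) by (auto simp: A'_def)
      have "(w \<circ> Suc) ` {..<k} \<subseteq> w ` {..<Suc k}" by auto
      moreover have "inj_on (w \<circ> Suc) {..<k}"
        using Suc.prems(5) by (auto simp: generic_def inj_on_def)
      moreover have "insert 0 ((\<lambda>a. t * x a) ` A') \<subseteq> insert 0 ((\<lambda>a. t * x a) ` A)"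
        by (auto simp: A(1))
      ultimately have gen: "generic (insert 0 ((\<lambda>a. t * x a) ` A')) k (w \<circ> Suc)"
        using Suc.prems(5) unfolding generic_def by (meson disjoint_iff subsetD)
      have "creation_eval t x A' k (w \<circ> Suc) = determinant_eval t x A' k (w \<circ> Suc)"
        using Suc.prems by (intro Suc.IH[OF A(3) _ _ Suc.prems(4) gen]) (auto simp: A(1) inj_on_def)
      thus ?thesis
        using creation_eval_residue[OF A(2,3) Suc.prems(4), of x w' k]
          determinant_eval_residue[OF A(2,3), of w' t x k] Suc.prems(2) w0 2
        unfolding wS A(1) by simp
    next
      case 3
      have eq: "w' 0 = w' r" using 3 by (simp add: w'_def)
      have "det (mat (Suc k) (Suc k) (\<lambda>(r, c). w' r ^ c)) = 0"
        by (rule det_equal_rows[of 0 _ r]) (use 3 eq in auto)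
      moreover have "determinant_eval t x A (Suc k) w' = 0"
        unfolding determinant_eval_def by (rule det_equal_rows[of 0 _ r]) (use 3 eq in auto)
      ultimately show ?thesis by (simp add: creation_eval_def)
    qed
    ultimately show ?thesis by simp
  qed
  ultimately have "B s = 0" if "s < D" for s
    using coefficients_zero[of D Y B s] that by simp
  hence "T ((\<lambda>r s. w r ^ s)(0 := (\<lambda>s. w 0 ^ s))) = 0"
    unfolding B by simp
  moreover have "(\<lambda>r s. w r ^ s)(0 := (\<lambda>s. w 0 ^ s)) = (\<lambda>r s. w r ^ s)" by auto
  ultimately show ?case using T by simp
qed

lemma creation_form_eq:
  fixes x :: "'i \<Rightarrow> 'a :: field_char_0"
  assumes "finite A" "inj_on x A" "0 \<notin> x ` A" "t \<noteq> 0"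
  shows "creation_form t x A k v = determinant_form t x A k v"
proof -
  have "creation_form t x A k v - determinant_form t x A k v = 0"
  proof (rule row_linear_zero_extend[OF row_linear_creation_diff])
    show "finite (insert 0 ((\<lambda>a. t * x a) ` A))" using assms(1) by simp
    fix v v' :: "nat \<Rightarrow> nat \<Rightarrow> 'a" assume v: "\<And>r. r < k \<Longrightarrow> v r = v' r"
    have "det (mat k k (\<lambda>(r, c). row_val D (v r) (p c))) =
        det (mat k k (\<lambda>(r, c). row_val D (v' r) (p c)))" for D p
      by (intro det_mat_cong) (simp add: v)
    thus "creation_form t x A k v - determinant_form t x A k v =
        creation_form t x A k v' - determinant_form t x A k v'"
      by (simp add: creation_form_def determinant_form_def)
  next
    fix w assume "generic (insert 0 ((\<lambda>a. t * x a) ` A)) k w"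
    thus "creation_form t x A k (\<lambda>r s. w r ^ s) - determinant_form t x A k (\<lambda>r s. w r ^ s) = 0"
      using creation_eval_eq[OF assms]
      by (simp add: creation_form_powers determinant_form_powers assms(1))
  qed
  thus ?thesis by simp
qed

section \<open>Generating functions of the plethysms\<close>

text \<open>\<open>F\<close> is \<open>exp\<close> of the sum of \<open>a i * z^i / i\<close> over
  \<open>i > 0\<close>, characterized by its logarithmic derivative. With power sums for
  \<open>a\<close> it is the generating function of the complete functions, and the coefficientwise
  form of the equation is Newton's recursion.\<close>

definition newton_series :: "(nat \<Rightarrow> 'a :: field_char_0) \<Rightarrow> 'a fps \<Rightarrow> bool" where
  "newton_series a F \<longleftrightarrow> fps_nth F 0 = 1 \<and> fps_deriv F = Abs_fps (\<lambda>i. a (Suc i)) * F"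

lemma newton_series_iff:
  "newton_series a F \<longleftrightarrow> fps_nth F 0 = 1 \<and>
     (\<forall>j. of_nat (Suc j) * fps_nth F (Suc j) = (\<Sum>i\<le>j. a (Suc i) * fps_nth F (j - i)))"
  by (auto simp: newton_series_def fps_eq_iff fps_mult_nth atLeast0AtMost simp del: of_nat_Suc)

lemma newton_series_cong:
  assumes "newton_series a F" "\<And>i. i > 0 \<Longrightarrow> a i = b i"
  shows "newton_series b F"
  using assms by (simp add: newton_series_def)

lemma newton_series_unique:
  assumes "newton_series a F" "newton_series a G"
  shows "F = G"
proof (rule fps_ext)
  fix j show "fps_nth F j = fps_nth G j"
  proof (induction j rule: less_induct)
    case (less j)
    show ?case
    proof (cases j)
      case 0
      thus ?thesis using assms by (simp add: newton_series_def)
    next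
      case (Suc l)
      have "of_nat (Suc l) * fps_nth F (Suc l) = of_nat (Suc l) * fps_nth G (Suc l)"
        using assms less unfolding newton_series_iff Suc by (simp del: of_nat_Suc)
      thus ?thesis by (simp add: Suc del: of_nat_Suc)
    qed
  qed
qed

text \<open>Logarithmic derivatives add under multiplication.\<close>

lemma newton_series_mult:
  assumes "newton_series a F" "newton_series b G"
  shows "newton_series (\<lambda>i. a i + b i) (F * G)"
proof -
  have "Abs_fps (\<lambda>i. a (Suc i) + b (Suc i)) = Abs_fps (\<lambda>i. a (Suc i)) + Abs_fps (\<lambda>i. b (Suc i))"
    by (simp add: fps_eq_iff)
  thus ?thesis
    using assms by (simp add: newton_series_def algebra_simps)
qed

text \<open>The geometric series gives the logarithmic derivative of \<open>1 - y z\<close>; this is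
  the series of one letter \<open>y\<close> taken negatively.\<close>

lemma newton_series_linear: "newton_series (\<lambda>i. - (y ^ i)) (1 - fps_const y * fps_X)"
proof -
  have "fps_const (- y) = Abs_fps (\<lambda>i. - (y ^ Suc i)) * (1 - fps_const y * fps_X)"
  proof (rule fps_ext)
    fix i show "fps_nth (fps_const (- y)) i =
      fps_nth (Abs_fps (\<lambda>i. - (y ^ Suc i)) * (1 - fps_const y * fps_X)) i"
      by (cases i) (simp_all add: right_diff_distrib mult.assoc[symmetric] fps_mult_right_const_nth)
  qed
  thus ?thesis by (simp add: newton_series_def)
qed

lemma newton_series_prod:
  "newton_series (\<lambda>i. - (\<Sum>j\<in>J. y j ^ i)) (\<Prod>j\<in>J. 1 - fps_const (y j) * fps_X)"
proof (induction J rule: infinite_finite_induct)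
  case (insert a J)
  show ?case
    using newton_series_mult[OF newton_series_linear[of "y a"] insert(3)] insert(1,2) by simp
qed (simp_all add: newton_series_def fps_eq_iff)

section \<open>Complete functions as Newton series, and their images under substitutions\<close>

definition S_series :: "ratfun \<Rightarrow> ratfun fps" where
  "S_series E = Abs_fps (\<lambda>j. plethysm (complete_sym j) E)"

text \<open>Indices \<open>lam r - r + c\<close> may be negative; extension by zero makes
  \<open>int_coeff_linear\<close> valid at every integer.\<close>

definition int_coeff :: "'a :: field fps \<Rightarrow> int \<Rightarrow> 'a" where
  "int_coeff F j = (if j < 0 then 0 else fps_nth F (nat j))"

lemma S_pleth_eq_int_coeff: "S_pleth j E = int_coeff (S_series E) j"
  by (simp add: S_pleth_def int_coeff_def S_series_def)

lemma newton_series_S_series: "newton_series (\<lambda>i. plet_p i E) (S_series E)"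
  unfolding newton_series_iff S_series_def fps_nth_Abs_fps
  by (intro conjI allI plethysm_complete_0 plethysm_complete_Suc)

text \<open>A good substitution is a field endomorphism fixing the rationals, so it preserves
  Newton's recursion.\<close>

lemma newton_series_subst:
  assumes "good_subst \<sigma>"
  shows "newton_series (\<lambda>i. subst \<sigma> (plet_p i E)) (Abs_fps (\<lambda>j. subst \<sigma> (fps_nth (S_series E) j)))"
proof -
  interpret good_subst \<sigma> by fact
  have "of_nat (Suc j) * subst \<sigma> (fps_nth (S_series E) (Suc j)) =
      (\<Sum>i\<le>j. subst \<sigma> (plet_p (Suc i) E) * subst \<sigma> (fps_nth (S_series E) (j - i)))" for j
  proof -
    have "subst \<sigma> (of_nat (Suc j) * fps_nth (S_series E) (Suc j)) =
      subst \<sigma> (\<Sum>i\<le>j. plet_p (Suc i) E * fps_nth (S_series E) (j - i))"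
      using newton_series_S_series[of E] by (simp only: newton_series_iff)
    moreover have "subst \<sigma> (of_nat m) = of_nat m" for m
      using of_rat[of "of_nat m"] by simp
    ultimately show ?thesis by (simp only: mult sum)
  qed
  moreover have "subst \<sigma> (fps_nth (S_series E) 0) = 1"
    using newton_series_S_series[of E] one by (simp add: newton_series_iff)
  ultimately show ?thesis by (simp only: newton_series_iff fps_nth_Abs_fps simp_thms)
qed

section \<open>Distinctness of monomials and indeterminates as rational functions\<close>

lemma mono_ind_inject: "mono_ind m = mono_ind m' \<longleftrightarrow> m = m'"
proof
  assume "mono_ind m = mono_ind m'"
  hence "Poly_Mapping.single m (1 :: rat) = Poly_Mapping.single m' 1"
    by (simp add: mono_ind_def eq_fract)
  hence "Poly_Mapping.keys (Poly_Mapping.single m (1 :: rat)) =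
      Poly_Mapping.keys (Poly_Mapping.single m' (1 :: rat))" by (rule arg_cong)
  thus "m = m'" by simp
qed simp

lemma ind_inject: "ind v = ind v' \<longleftrightarrow> v = v'"
proof
  assume "ind v = ind v'"
  hence "Poly_Mapping.single v (1 :: nat) = Poly_Mapping.single v' 1"
    by (simp add: ind_eq_mono_ind mono_ind_inject)
  hence "Poly_Mapping.keys (Poly_Mapping.single v (1 :: nat)) =
      Poly_Mapping.keys (Poly_Mapping.single v' (1 :: nat))" by (rule arg_cong)
  thus "v = v'" by simp
qed simp

lemma ind_nonzero: "ind v \<noteq> 0"
proof
  assume "ind v = 0"
  hence "Poly_Mapping.single (Poly_Mapping.single v (1 :: nat)) (1 :: rat) = 0"
    by (simp add: ind_def Zero_fract_def eq_fract)
  hence "Poly_Mapping.lookup (Poly_Mapping.single (Poly_Mapping.single v (1 :: nat)) (1 :: rat))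
    (Poly_Mapping.single v 1) = 0" by simp
  thus False by simp
qed

lemma ind_power_neq_1:
  assumes "i > 0"
  shows "ind v ^ i \<noteq> 1"
proof
  assume "ind v ^ i = 1"
  hence "mono_ind (Poly_Mapping.single v i) = mono_ind 0" by (simp add: mono_ind_power)
  hence "Poly_Mapping.single v i = 0" by (simp only: mono_ind_inject)
  hence "Poly_Mapping.lookup (Poly_Mapping.single v i) v = 0" by simp
  thus False using assms by simp
qed

section \<open>The effect of shifting variables on the alphabet and on its complete
  functions\<close>

definition X_tq_shifted :: "nat \<Rightarrow> nat set \<Rightarrow> ratfun" where
  "X_tq_shifted n J = X_tq n + (\<Sum>j\<in>J. xvar j * (tvar - 1))"

lemma plet_p_X_tq:
  assumes "i > 0"
  shows "plet_p i (X_tq n) = (\<Sum>j = 1..n. xvar j ^ i) * (tvar ^ i - 1) / (qvar ^ i - 1)"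
proof -
  interpret good_subst "\<lambda>v. ind v ^ i" using assms by (rule good_subst_adams)
  show ?thesis
    by (simp add: plet_p_def X_tq_def X_alph_def divide mult diff sum)
qed

lemma plet_p_X_tq_shifted:
  assumes "i > 0"
  shows "plet_p i (X_tq_shifted n J) = plet_p i (X_tq n) + (\<Sum>j\<in>J. xvar j ^ i * (tvar ^ i - 1))"
proof -
  interpret good_subst "\<lambda>v. ind v ^ i" using assms by (rule good_subst_adams)
  show ?thesis
    by (simp add: plet_p_def X_tq_shifted_def mult diff sum add)
qed

text \<open>Each shifted letter contributes \<open>(q x_j)^i = x_j^i + (q^i - 1) x_j^i\<close>, and
  the factor \<open>q^i - 1\<close> cancels the denominator.\<close>

lemma shift_plet_p_X_tq:
  assumes i: "i > 0" and J: "J \<subseteq> {1..n}"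
  shows "shift_set J (plet_p i (X_tq n)) = plet_p i (X_tq_shifted n J)"
proof -
  interpret good_subst "\<lambda>v. if v \<in> IndX ` J then qvar * ind v else ind v"
    by (rule good_subst_shift)
  have q: "qvar ^ i - 1 \<noteq> 0" using ind_power_neq_1[OF i] by simp
  have "shift_set J (plet_p i (X_tq n)) =
      (\<Sum>j = 1..n. (if j \<in> J then qvar * xvar j else xvar j) ^ i) * (tvar ^ i - 1) / (qvar ^ i - 1)"
    unfolding plet_p_X_tq[OF i] divide mult diff sum power ind one by (simp add: image_iff)
  also have "(\<Sum>j = 1..n. (if j \<in> J then qvar * xvar j else xvar j) ^ i) =
      (\<Sum>j = 1..n. xvar j ^ i + (if j \<in> J then (qvar ^ i - 1) * xvar j ^ i else 0))"
    by (intro sum.cong) (auto simp: power_mult_distrib algebra_simps)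
  also have "\<dots> = (\<Sum>j = 1..n. xvar j ^ i) + (qvar ^ i - 1) * (\<Sum>j\<in>J. xvar j ^ i)"
  proof -
    have "{1..n} \<inter> J = J" using J by auto
    thus ?thesis by (simp add: sum.distrib sum.If_cases sum_distrib_left)
  qed
  finally have shift: "shift_set J (plet_p i (X_tq n)) = ((\<Sum>j = 1..n. xvar j ^ i) +
      (qvar ^ i - 1) * (\<Sum>j\<in>J. xvar j ^ i)) * (tvar ^ i - 1) / (qvar ^ i - 1)" .
  show ?thesis
    unfolding shift unfolding plet_p_X_tq_shifted[OF i] plet_p_X_tq[OF i] sum_distrib_right[symmetric]
    using q by (simp add: field_simps)
qed

text \<open>Both sides are coefficients of Newton series with the same power sums, and such a series
  is unique.\<close>

lemma shift_S_pleth_X_tq: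
  assumes "J \<subseteq> {1..n}"
  shows "shift_set J (S_pleth j (X_tq n)) = S_pleth j (X_tq_shifted n J)"
proof -
  interpret good_subst "\<lambda>v. if v \<in> IndX ` J then qvar * ind v else ind v"
    by (rule good_subst_shift)
  have "Abs_fps (\<lambda>j. shift_set J (fps_nth (S_series (X_tq n)) j)) = S_series (X_tq_shifted n J)"
    by (rule newton_series_unique[OF newton_series_cong[OF newton_series_subst] newton_series_S_series])
      (use shift_plet_p_X_tq assms good_subst_shift in auto)
  hence "shift_set J (fps_nth (S_series (X_tq n)) j) = fps_nth (S_series (X_tq_shifted n J)) j" for j
    by (simp add: fps_eq_iff)
  thus ?thesis by (simp add: S_pleth_eq_int_coeff int_coeff_def)
qed

lemma Theta_set_eq_shift_set:
  assumes "finite J"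
  shows "Theta_set J f = shift_set J f"
  using assms
proof (induction J)
  case empty
  \<comment> \<open>\<open>subst\<close> is a definite description over fractions, so the trivial
    substitution is evaluated on numerator and denominator.\<close>
  have "shift_set {} f = f"
  proof (cases f)
    case (Fract a b)
    have 1: "eval_rpoly ind p = Fract p 1" for p
    proof -
      have "eval_rpoly (\<lambda>v. mono_ind (Poly_Mapping.single v 1)) p = Fract p 1"
      proof -
        have "mono_map (\<lambda>v. Poly_Mapping.single v 1) m = m" for m :: "indet \<Rightarrow>\<^sub>0 nat"
          by (rule poly_mapping_eqI)
            (simp add: lookup_mono_map lookup_single when_def in_keys_iff if_distrib[of "\<lambda>z. _ * z"] cong: if_cong)
        thus ?thesis by (simp add: eval_rpoly_mono_ind rpoly_sum_monomials)
      qed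
      thus ?thesis by (simp add: ind_eq_mono_ind[abs_def])
    qed
    have "shift_set {} (Fract a b) = Fract a 1 / Fract b 1"
      using subst_shift[of b "{}" a] Fract(2) 1 by simp
    thus ?thesis using Fract by simp
  qed
  thus ?case by simp
next
  case (insert l J)
  show ?case
    unfolding Theta_set_insert[OF insert(1,2)] insert(3) by (rule Theta_shift_set[OF insert(2)])
qed

lemma subst_det:
  assumes "good_subst \<sigma>"
  shows "subst \<sigma> (det (mat k k (\<lambda>(r, c). f r c))) = det (mat k k (\<lambda>(r, c). subst \<sigma> (f r c)))"
proof -
  interpret good_subst \<sigma> by fact
  have "subst \<sigma> (of_int (sign p)) = of_int (sign p)" for p :: "nat \<Rightarrow> nat"
    by (simp add: sign_def uminus)
  thus ?thesis unfolding det_mat_leibniz by (simp only: sum mult prod)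
qed

text \<open>In power sums the shift adds \<open>(t x_j)^i - x_j^i\<close> for each \<open>j\<close>
  in \<open>J\<close>, while a factor \<open>1 - y z\<close> subtracts \<open>y^i\<close>. Both
  sides therefore have the same power sums.\<close>

lemma S_series_X_tq_shifted:
  assumes "J \<subseteq> {1..n}"
  shows "S_series (X_tq_shifted n J) * (\<Prod>j\<in>J. 1 - fps_const (tvar * xvar j) * fps_X) =
    S_series (X_tq n) * (\<Prod>j\<in>J. 1 - fps_const (xvar j) * fps_X)"
proof (rule newton_series_unique)
  show "newton_series (\<lambda>i. plet_p i (X_tq n) + - (\<Sum>j\<in>J. xvar j ^ i))
      (S_series (X_tq n) * (\<Prod>j\<in>J. 1 - fps_const (xvar j) * fps_X))"
    by (intro newton_series_mult newton_series_S_series newton_series_prod)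
  show "newton_series (\<lambda>i. plet_p i (X_tq n) + - (\<Sum>j\<in>J. xvar j ^ i))
      (S_series (X_tq_shifted n J) * (\<Prod>j\<in>J. 1 - fps_const (tvar * xvar j) * fps_X))"
    by (rule newton_series_cong[OF newton_series_mult[OF newton_series_S_series newton_series_prod]])
      (simp add: plet_p_X_tq_shifted power_mult_distrib algebra_simps sum_subtractf)
qed

section \<open>Plethystic complete functions as row functionals\<close>

lemma int_coeff_linear:
  "int_coeff (F * (1 - fps_const y * fps_X)) j = int_coeff F j - y * int_coeff F (j - 1)"
proof (cases "j \<ge> 0")
  case True
  then obtain m where m: "j = int m" by (metis nonneg_int_cases)
  have "F * (1 - fps_const y * fps_X) = F - fps_const y * (F * fps_X)"
    by (simp add: algebra_simps)
  thus ?thesis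
    by (cases m) (simp_all add: int_coeff_def m nat_add_distrib)
qed (simp add: int_coeff_def)

text \<open>The substitution \<open>w = 1/z\<close> turns the factors \<open>w - y\<^sub>j\<close> into \<open>1 - y\<^sub>j z\<close>.\<close>

lemma row_val_int_coeff:
  fixes y :: "'i \<Rightarrow> 'a :: field"
  assumes "finite A" "c < d"
  shows "row_val (d + card A) (\<lambda>s. int_coeff F (m + int s)) (monom 1 c * (\<Prod>j\<in>A. [:- y j, 1:])) =
    int_coeff (F * (\<Prod>j\<in>A. 1 - fps_const (y j) * fps_X)) (m + int c + int (card A))"
  using assms(1)
proof (induction A arbitrary: m)
  case empty
  have "row_val d (\<lambda>s. int_coeff F (m + int s)) (monom 1 c) = (\<Sum>s<d. if s = c then int_coeff F (m + int c) else 0)"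
    unfolding row_val_def by (intro sum.cong) auto
  thus ?case using assms(2) by simp
next
  case (insert a A)
  define N where "N = monom 1 c * (\<Prod>j\<in>A. [:- y j, 1:])"
  define D where "D = d + card A"
  let ?u = "\<lambda>m s. int_coeff F (m + int s)"
  let ?G = "F * (\<Prod>j\<in>A. 1 - fps_const (y j) * fps_X)"
  have "degree N \<le> c + card A"
  proof -
    have "degree (\<Prod>j\<in>A. [:- y j, 1:]) = card A"
      by (simp add: degree_prod_eq_sum_degree)
    thus ?thesis
      using degree_mult_le[of "monom 1 c" "\<Prod>j\<in>A. [:- y j, 1:]"] degree_monom_le[of "1 :: 'a" c]
      unfolding N_def by linarith
  qed
  \<comment> \<open>Since \<open>c < d\<close>, the degree of \<open>N\<close> is below
    \<open>D\<close>, and lengthening the row sum by one term changes nothing.\<close>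
  hence "coeff N D = 0" using assms(2) by (intro coeff_eq_0) (simp add: D_def)
  hence low: "row_val (Suc D) (?u m) N = row_val D (?u m) N"
    by (simp add: row_val_def)
  \<comment> \<open>Multiplication by \<open>w\<close> advances the sequence by one place; this is
    why the induction is over arbitrary \<open>m\<close>.\<close>
  have high: "row_val (Suc D) (?u m) (pCons 0 N) = row_val D (?u (m + 1)) N"
    unfolding row_val_def sum.lessThan_Suc_shift by (simp add: add_ac)
  have "monom 1 c * (\<Prod>j\<in>insert a A. [:- y j, 1:]) = pCons 0 N - smult (y a) N"
    using insert(1,2) by (simp add: N_def algebra_simps)
  hence "row_val (Suc D) (?u m) (monom 1 c * (\<Prod>j\<in>insert a A. [:- y j, 1:])) =
      row_val (Suc D) (?u m) (pCons 0 N) - y a * row_val (Suc D) (?u m) N"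
    by (simp only: row_val_def coeff_diff coeff_smult right_diff_distrib sum_subtractf
        sum_distrib_left mult.left_commute)
  also have "\<dots> = int_coeff ?G (m + 1 + int c + int (card A)) -
      y a * int_coeff ?G (m + int c + int (card A))"
    unfolding low high using insert.IH by (simp only: N_def D_def)
  also have "\<dots> = int_coeff (?G * (1 - fps_const (y a) * fps_X)) (m + 1 + int c + int (card A))"
    unfolding int_coeff_linear by (simp add: add_ac)
  finally show ?case
    using insert(1,2) by (simp add: D_def mult_ac add_ac)
qed

text \<open>\<open>H\<close> is the series of \<open>X_tq n\<close> divided by the common
  denominator, so each shifted series is \<open>H\<close> times \<open>n\<close> linear factors:
  with \<open>x_j\<close> for \<open>j\<close> in \<open>J\<close> and \<open>t x_j\<close>
  otherwise. The offset \<open>- int n\<close> compensates the \<open>card A\<close> added by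
  \<open>row_val_int_coeff\<close>.\<close>

lemma row_val_S_pleth:
  fixes n :: nat
  defines "H \<equiv> S_series (X_tq n) * inverse (\<Prod>j = 1..n. 1 - fps_const (tvar * xvar j) * fps_X)"
  assumes J: "J \<subseteq> {1..n}" and "c < d"
  shows "row_val (n + d) (\<lambda>s. int_coeff H (m - int n + int s))
      (monom 1 c * shift_poly tvar xvar {1..n} J) = S_pleth (m + int c) (X_tq_shifted n J)"
proof -
  let ?P = "\<lambda>y K. \<Prod>j\<in>K. 1 - fps_const (y j :: ratfun) * fps_X"
  have nz: "fps_nth (?P y K) 0 = 1" for y and K :: "nat set"
    by (induction K rule: infinite_finite_induct) auto
  have fin: "finite J" using J finite_subset by blast
  have H: "H * ?P (\<lambda>j. tvar * xvar j) {1..n} = S_series (X_tq n)"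
    unfolding H_def using nz[of "\<lambda>j. tvar * xvar j" "{1..n}"]
    by (simp add: mult.assoc inverse_mult_eq_1)
  have split: "(\<Prod>j\<in>{1..n}. if j \<in> J then f j else g j) = (\<Prod>j\<in>J. f j) * (\<Prod>j\<in>{1..n} - J. g j)"
    for f g :: "nat \<Rightarrow> 'b :: comm_monoid_mult"
    using prod.subset_diff[OF J finite_atLeastAtMost, of "\<lambda>j. if j \<in> J then f j else g j"]
    by (simp add: mult.commute)
  define y where "y j = (if j \<in> J then xvar j else tvar * xvar j)" for j
  have poly: "shift_poly tvar xvar {1..n} J = (\<Prod>j = 1..n. [:- y j, 1:])"
    unfolding shift_poly_def split[symmetric] y_def by (intro prod.cong) auto
  have fps: "?P y {1..n} = ?P xvar J * ?P (\<lambda>j. tvar * xvar j) ({1..n} - J)"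
    unfolding split[symmetric] y_def by (intro prod.cong) auto
  have "S_series (X_tq_shifted n J) * ?P (\<lambda>j. tvar * xvar j) J =
      H * ?P (\<lambda>j. tvar * xvar j) {1..n} * ?P xvar J"
    unfolding H by (rule S_series_X_tq_shifted[OF J])
  also have "\<dots> = (H * ?P y {1..n}) * ?P (\<lambda>j. tvar * xvar j) J"
    unfolding fps prod.subset_diff[OF J finite_atLeastAtMost] by (simp only: mult_ac)
  finally have series: "S_series (X_tq_shifted n J) = H * ?P y {1..n}"
    using nz[of "\<lambda>j. tvar * xvar j" J] by auto
  show ?thesis
    using row_val_int_coeff[of "{1..n}" c d H "m - int n" y] \<open>c < d\<close>
    unfolding poly S_pleth_eq_int_coeff series by (simp add: add.commute)
qed

section \<open>The creation operator on a Schur function\<close>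

theorem theorem4p2:
  fixes n k :: nat and lam :: "nat \<Rightarrow> nat"
  assumes "1 \<le> k" and "k \<le> n"
    and partition: "\<And>r s. 1 \<le> r \<Longrightarrow> r \<le> s \<Longrightarrow> s \<le> k \<Longrightarrow> lam s \<le> lam r"
  shows "creation_op n k (schur k lam (X_tq n)) =
    det1 k (\<lambda>r c. S_pleth (int (lam r) - int r + int c + 1) (X_tq n)
                - tvar ^ (k - c) * S_pleth (int (lam r) - int r + int c + 1) (X_tq n + X_t n))"
proof -
  let ?A = "{1..n}"
  define H where
    "H = S_series (X_tq n) * inverse (\<Prod>j = 1..n. 1 - fps_const (tvar * xvar j) * fps_X)"
  \<comment> \<open>Rows and columns now count from 0; the two offsets cancel in the index on the
    left-hand side, so the row index is \<open>m r + int c\<close>.\<close>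
  define m where "m r = int (lam (Suc r)) - int r" for r
  define v where "v r s = int_coeff H (m r - int n + int s)" for r s
  \<comment> \<open>The products in \<open>resultant_R\<close> run over sets of letters; injectivity
    turns them into products over indices.\<close>
  have injx: "inj_on xvar S" for S
    by (auto simp: inj_on_def ind_inject)
  have injt: "inj_on (\<lambda>j. xvar j / tvar) S" for S
    by (auto simp: inj_on_def ind_inject ind_nonzero)
  have schur: "Theta_set J (schur k lam (X_tq n)) =
      det (mat k k (\<lambda>(r, c). row_val (n + k) (v r) (monom 1 c * shift_poly tvar xvar ?A J)))"
    if J: "J \<subseteq> ?A" for J
  proof -
    have "Theta_set J (schur k lam (X_tq n)) =
        det (mat k k (\<lambda>(r, c). shift_set J
          (S_pleth (int (lam (Suc r)) - int (Suc r) + int (Suc c)) (X_tq n))))"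
      unfolding Theta_set_eq_shift_set[OF finite_subset[OF J finite_atLeastAtMost]] schur_def det1_def
      by (rule subst_det) (rule good_subst_shift)
    also have "\<dots> =
        det (mat k k (\<lambda>(r, c). row_val (n + k) (v r) (monom 1 c * shift_poly tvar xvar ?A J)))"
    proof (rule det_mat_cong)
      fix r c assume "c < k"
      moreover have "int (lam (Suc r)) - int (Suc r) + int (Suc c) = m r + int c"
        by (simp add: m_def)
      ultimately show "shift_set J (S_pleth (int (lam (Suc r)) - int (Suc r) + int (Suc c)) (X_tq n)) =
          row_val (n + k) (v r) (monom 1 c * shift_poly tvar xvar ?A J)"
        unfolding v_def H_def by (simp only: shift_S_pleth_X_tq[OF J] row_val_S_pleth[OF J])
    qed
    finally show ?thesis .
  qed
  have "creation_op n k (schur k lam (X_tq n)) = creation_form tvar xvar ?A k v"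
    unfolding creation_op_def creation_form_def
  proof (rule sum.cong[OF refl])
    fix I assume I: "I \<in> {I. I \<subseteq> ?A \<and> card I = k}"
    hence finI: "finite I" using finite_subset by auto
    define g where "g J = (- tvar) ^ card J * crossing_weight tvar xvar I J *
        Theta_set J (schur k lam (X_tq n))" for J
    have R: "(\<Prod>i\<in>I. xvar i) * (resultant_R (xvar ` I) ((\<lambda>j. xvar j / tvar) ` (?A - I)) /
        resultant_R (xvar ` I) (xvar ` (?A - I))) = choice_weight tvar xvar ?A I"
      unfolding resultant_R_def choice_weight_def
      by (simp add: prod.reindex injx injt prod_dividef)
    have "(\<Sum>l\<le>k. (- tvar) ^ l * (\<Prod>i\<in>I. xvar i) *
        (resultant_R (xvar ` I) ((\<lambda>j. xvar j / tvar) ` (?A - I)) /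
         resultant_R (xvar ` I) (xvar ` (?A - I))) *
        macdonald_op I l (schur k lam (X_tq n))) =
      (\<Sum>l\<le>k. \<Sum>J | J \<in> Pow I \<and> card J = l. choice_weight tvar xvar ?A I * g J)"
    proof (rule sum.cong[OF refl])
      fix l
      have "(- tvar) ^ l * (\<Prod>i\<in>I. xvar i) *
          (resultant_R (xvar ` I) ((\<lambda>j. xvar j / tvar) ` (?A - I)) /
           resultant_R (xvar ` I) (xvar ` (?A - I))) *
          macdonald_op I l (schur k lam (X_tq n)) =
        choice_weight tvar xvar ?A I * ((- tvar) ^ l * macdonald_op I l (schur k lam (X_tq n)))"
        unfolding R[symmetric] by (simp only: mult_ac)
      also have "\<dots> = (\<Sum>J | J \<in> Pow I \<and> card J = l. choice_weight tvar xvar ?A I * g J)"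
        unfolding macdonald_op_def sum_distrib_left Pow_iff
        by (intro sum.cong refl) (auto simp: g_def crossing_weight_def mult_ac)
      finally show "(- tvar) ^ l * (\<Prod>i\<in>I. xvar i) *
          (resultant_R (xvar ` I) ((\<lambda>j. xvar j / tvar) ` (?A - I)) /
           resultant_R (xvar ` I) (xvar ` (?A - I))) *
          macdonald_op I l (schur k lam (X_tq n)) = \<dots>" .
    qed
    \<comment> \<open>Every subset of \<open>I\<close> has some size
      \<open>l \<le> k = card I\<close>, so the double sum runs over all subsets once.\<close>
    also have "\<dots> = (\<Sum>J\<in>Pow I. choice_weight tvar xvar ?A I * g J)"
      by (rule sum.group) (use I finI in \<open>auto intro: card_mono\<close>)
    also have "\<dots> = choice_weight tvar xvar ?A I *
     (\<Sum>J\<in>Pow I. (- tvar) ^ card J * crossing_weight tvar xvar I J *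
       det (mat k k (\<lambda>(r, c). row_val (card ?A + k) (v r) (monom 1 c * shift_poly tvar xvar ?A J))))"
      unfolding sum_distrib_left g_def
    proof (rule sum.cong[OF refl])
      fix J assume "J \<in> Pow I"
      hence "J \<subseteq> ?A" using I by auto
      moreover have "card ?A = n" by simp
      ultimately show "choice_weight tvar xvar ?A I * ((- tvar) ^ card J *
          crossing_weight tvar xvar I J * Theta_set J (schur k lam (X_tq n))) =
        choice_weight tvar xvar ?A I * ((- tvar) ^ card J * crossing_weight tvar xvar I J *
          det (mat k k (\<lambda>(r, c). row_val (card ?A + k) (v r)
            (monom 1 c * shift_poly tvar xvar ?A J))))"
        by (simp only: schur)
    qed
    finally show "(\<Sum>l\<le>k. (- tvar) ^ l * (\<Prod>i\<in>I. xvar i) *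
        (resultant_R (xvar ` I) ((\<lambda>j. xvar j / tvar) ` (?A - I)) /
         resultant_R (xvar ` I) (xvar ` (?A - I))) *
        macdonald_op I l (schur k lam (X_tq n))) = \<dots>" .
  qed
  also have "\<dots> = determinant_form tvar xvar ?A k v"
    by (rule creation_form_eq) (use ind_nonzero in \<open>auto intro: injx\<close>)
  also have "\<dots> = det1 k (\<lambda>r c. S_pleth (int (lam r) - int r + int c + 1) (X_tq n)
                - tvar ^ (k - c) * S_pleth (int (lam r) - int r + int c + 1) (X_tq n + X_t n))"
    unfolding determinant_form_def det1_def
  proof (rule det_mat_cong)
    fix r c assume rc: "r < k" "c < k"
    let ?N = "\<lambda>J. monom 1 (Suc c) * shift_poly tvar xvar ?A J"
    let ?M = "monom 1 (Suc c) *
      (shift_poly tvar xvar ?A {} - smult (tvar ^ (k - Suc c)) (shift_poly tvar xvar ?A ?A))"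
    have M: "?M = ?N {} - smult (tvar ^ (k - Suc c)) (?N ?A)"
      by (simp add: right_diff_distrib)
    \<comment> \<open>The two summands of \<open>?M\<close> separately may have degree
      \<open>n + k\<close>; only their difference stays below it. The row sum is lengthened by this
      zero term before it is split.\<close>
    have "coeff ?M (n + k) = 0"
      by (rule coeff_shift_poly_diff_zero) (use rc in auto)
    hence "row_val (card ?A + k) (v r) ?M = row_val (n + Suc k) (v r) ?M"
      by (simp add: row_val_def)
    also have "\<dots> = row_val (n + Suc k) (v r) (?N {}) -
        tvar ^ (k - Suc c) * row_val (n + Suc k) (v r) (?N ?A)"
      unfolding M by (simp only: row_val_def coeff_diff coeff_smult right_diff_distrib sum_subtractf
          sum_distrib_left mult.left_commute)
    also have "\<dots> = S_pleth (m r + int (Suc c)) (X_tq_shifted n {}) -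
        tvar ^ (k - Suc c) * S_pleth (m r + int (Suc c)) (X_tq_shifted n ?A)"
      unfolding v_def H_def using rc by (subst (1 2) row_val_S_pleth) auto
    also have "X_tq_shifted n {} = X_tq n" by (simp add: X_tq_shifted_def)
    also have "X_tq_shifted n ?A = X_tq n + X_t n"
      by (simp add: X_tq_shifted_def X_t_def X_alph_def sum_distrib_right)
    also have "m r + int (Suc c) = int (lam (Suc r)) - int (Suc r) + int (Suc c) + 1"
      by (simp add: m_def)
    finally show "row_val (card ?A + k) (v r) ?M =
        S_pleth (int (lam (Suc r)) - int (Suc r) + int (Suc c) + 1) (X_tq n) -
        tvar ^ (k - Suc c) * S_pleth (int (lam (Suc r)) - int (Suc r) + int (Suc c) + 1) (X_tq n + X_t n)" .
  qed
  finally show ?thesis .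
qed

end
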